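(* Let $p,q\in\mathbb{N}$, let $\alpha_1\in(0,1)$ with $|\alpha_1-1/2|>1/\sqrt{12}$, $\alpha_2=1-\alpha_1$, let $\mathbf{A}\in\mathbb{R}^{p\times p}$ and $\mathbf{B}\in\mathbb{R}^{q\times q}$ be symmetric positive definite, let $\mathbf{T}_1\neq\mathbf{T}_2$ be matrices in $\mathbb{R}^{p\times q}$, and let $\mathbf{X}_1,\mathbf{X}_2,\ldots$ be i.i.d. random $p\times q$ matrices with distribution $$\alpha_1\mathcal{N}_{p\times q}(\mathbf{T}_1,\mathbf{A},\mathbf{B})+\alpha_2\mathcal{N}_{p\times q}(\mathbf{T}_2,\mathbf{A},\mathbf{B}).$$ Let $d$ be the rank of $\mathbf{A}^{-1/2}(\mathbf{T}_2-\mathbf{T}_1)\mathbf{B}^{-1/2}$ and assume that the $d$ non-zero singular values of this matrix are distinct. For each $n>pq$, let $(\mathbf{u}_{n1},\mathbf{v}_{n1}),\ldots,(\mathbf{u}_{nd},\mathbf{v}_{nd})\in\mathbb{S}^{p-1}\times\mathbb{S}^{q-1}$ be any sequence of $(\mathcal{G}_{n1,\mathbf{X}},\mathcal{G}_{n2,\mathbf{X}})$-maximizers of $\kappa_{n\mathbf{X}}$. Then, as $n\to\infty$, $$\mathbf{W}_{n\mathrm{LDA}}:=\sum_{j=1}^d s_{nj}\,z_{nj2}^{-1/2}\,\lambda_{nj}\sqrt{1+\alpha_1\alpha_2\lambda_{nj}^2}\;\mathbf{u}_{nj}\mathbf{v}_{nj}'\;\longrightarrow\;\mathbf{W}_{\mathrm{LDA}}:=\mathbf{A}^{-1}(\mathbf{T}_2-\mathbf{T}_1)\mathbf{B}^{-1}$$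 almost surely, where $s_{n1},\ldots,s_{nd}\in\{-1,0,1\}$ are the signs of the quantities $(\alpha_1-\alpha_2)^{-1}z_{nj3}$.
   Context: Prime denotes transpose, $\mathbb{S}^{p-1}$ is the unit sphere of $\mathbb{R}^p$, $\mathcal{U}_0:=\mathbb{S}^{p-1}\times\mathbb{S}^{q-1}$. $\mathcal{N}_{p\times q}(\mathbf{T},\mathbf{A},\mathbf{B})$ is the distribution of $\mathbf{T}+\mathbf{A}^{1/2}\mathbf{Z}\mathbf{B}^{1/2}$, where the entries of the $p\times q$ random matrix $\mathbf{Z}$ are i.i.d. standard normal and square roots are the symmetric positive definite ones; $\alpha_1 P_1+\alpha_2 P_2$ denotes the mixture distribution. Sample index, with $\bar{\mathbf{X}}=\frac1n\sum_{i=1}^n\mathbf{X}_i$ and $\mathbf{Y}_i=\mathbf{X}_i-\bar{\mathbf{X}}$ (almost surely well-defined on $\mathcal{U}_0$ for $n>pq$): $$\kappa_{n\mathbf{X}}(\mathbf{u},\mathbf{v}):=\frac{\frac1n\sum_{i=1}^n(\mathbf{u}'\mathbf{Y}_i\mathbf{v})^4}{\left(\frac1n\sum_{i=1}^n(\mathbf{u}'\mathbf{Y}_i\mathbf{v})^2\right)^2}.$$ Given pairs $(\mathbf{u}_{n1},\mathbf{v}_{n1}),\ldots,(\mathbf{u}_{nd},\mathbf{v}_{nd})\in\mathcal{U}_0$, put, for $k=1,\ldots,d-1$, $\mathbf{G}_{n1k,\mathbf{X}}:=\frac1n\sum_{i=1}^n\mathbf{Y}_i\mathbf{v}_{nk}\mathbf{v}_{nk}'\mathbf{Y}_i'$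 and $\mathbf{G}_{n2k,\mathbf{X}}:=\frac1n\sum_{i=1}^n\mathbf{Y}_i'\mathbf{u}_{nk}\mathbf{u}_{nk}'\mathbf{Y}_i$, and let $\mathcal{G}_{n1,\mathbf{X}},\mathcal{G}_{n2,\mathbf{X}}$ be the corresponding collections. The pairs form a sequence of $(\mathcal{G}_{n1,\mathbf{X}},\mathcal{G}_{n2,\mathbf{X}})$-maximizers of $g:\mathcal{U}_0\to\mathbb{R}$ if $(\mathbf{u}_{n1},\mathbf{v}_{n1})$ maximizes $g$ in $\mathcal{U}_0$ and, for each $j=2,\ldots,d$, $(\mathbf{u}_{nj},\mathbf{v}_{nj})$ maximizes $g$ over those $(\mathbf{u},\mathbf{v})\in\mathcal{U}_0$ with $\mathbf{u}'\mathbf{G}_{n1k,\mathbf{X}}\mathbf{u}_{nk}=0$ and $\mathbf{v}'\mathbf{G}_{n2k,\mathbf{X}}\mathbf{v}_{nk}=0$ for all $k=1,\ldots,j-1$. Coefficients: $z_{njk}:=\frac1n\sum_{i=1}^n\{\mathbf{u}_{nj}'(\mathbf{X}_i-\bar{\mathbf{X}})\mathbf{v}_{nj}\}^k$, $$\theta_{nj}:=\sqrt{\max\left\{\frac{\kappa_{n\mathbf{X}}(\mathbf{u}_{nj},\mathbf{v}_{nj})-3}{\alpha_1\alpha_2(1-6\alpha_1\alpha_2)},0\right\}},\qquad \lambda_{nj}:=\sqrt{\max\left\{\frac{\theta_{nj}}{1-\alpha_1\alpha_2\theta_{nj}},0\right\}}$$ (with $\lambda_{nj}:=0$, say, if $1-\alpha_1\alpha_2\theta_{nj}=0$).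 *)

theory Defs
  imports "HOL-Probability.Probability"
begin

section \<open>Matrices\<close>

definition sym_pos_def :: "real^'n^'n \<Rightarrow> bool" where
  "sym_pos_def M \<longleftrightarrow> transpose M = M \<and> (\<forall>x. x \<noteq> 0 \<longrightarrow> x \<bullet> (M *v x) > 0)"

text \<open>Meaningful only for symmetric positive definite arguments.\<close>
definition mat_sqrt :: "real^'n^'n \<Rightarrow> real^'n^'n" where
  "mat_sqrt M = (THE S. sym_pos_def S \<and> S ** S = M)"

definition outer :: "real^'m \<Rightarrow> real^'n \<Rightarrow> real^'n^'m" where
  "outer u v = (\<chi> i j. u $ i * v $ j)"

text \<open>The singular values of \<open>M\<close> are the nonnegative square roots of the eigenvalues of
  \<open>M\<^sup>T M\<close>, each counted with the dimension of the eigenspace; multiplicity \<open>0\<close> means that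
  \<open>\<sigma>\<close> is not a singular value.\<close>
definition singular_value_mult :: "real^'n^'m \<Rightarrow> real \<Rightarrow> nat" where
  "singular_value_mult M \<sigma> =
     (if \<sigma> \<ge> 0 then dim {x. (transpose M ** M) *v x = \<sigma>\<^sup>2 *\<^sub>R x} else 0)"

definition nonzero_singular_values_distinct :: "real^'n^'m \<Rightarrow> bool" where
  "nonzero_singular_values_distinct M \<longleftrightarrow> (\<forall>\<sigma>. \<sigma> \<noteq> 0 \<longrightarrow> singular_value_mult M \<sigma> \<le> 1)"


section \<open>Matrix-variate normal distributions and mixtures\<close>

definition std_normal :: "real measure" where
  "std_normal = density lborel (\<lambda>x. ennreal (std_normal_density x))"

definition matrix_normal :: "real^'q^'p \<Rightarrow> real^'p^'p \<Rightarrow> real^'q^'q \<Rightarrow> (real^'q^'p) measure" where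
  "matrix_normal T A B =
     distr (\<Pi>\<^sub>M (ij :: 'p \<times> 'q) \<in> UNIV. std_normal) borel
       (\<lambda>z. T + mat_sqrt A ** (\<chi> i j. z (i, j)) ** mat_sqrt B)"

text \<open>\<open>P\<close> and \<open>Q\<close> are meant to live on the same measurable space.\<close>
definition mixture :: "real \<Rightarrow> 'a measure \<Rightarrow> real \<Rightarrow> 'a measure \<Rightarrow> 'a measure" where
  "mixture a P b Q = measure_of (space P) (sets P)
     (\<lambda>S. ennreal a * emeasure P S + ennreal b * emeasure Q S)"

lemma space_mixture [simp]: "space (mixture a P b Q) = space P"
  and sets_mixture [simp]: "sets (mixture a P b Q) = sets P"
  by (simp_all add: mixture_def)

lemma emeasure_mixture:
  assumes "sets Q = sets P" "S \<in> sets P"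
  shows "emeasure (mixture a P b Q) S = ennreal a * emeasure P S + ennreal b * emeasure Q S"
  unfolding mixture_def
proof (rule emeasure_measure_of_sigma[OF _ _ _ assms(2)])
  show "sigma_algebra (space P) (sets P)"
    by (rule sets.sigma_algebra_axioms)
  show "positive (sets P) (\<lambda>S. ennreal a * emeasure P S + ennreal b * emeasure Q S)"
    by (simp add: positive_def)
  show "countably_additive (sets P) (\<lambda>S. ennreal a * emeasure P S + ennreal b * emeasure Q S)"
  proof (rule countably_additiveI)
    fix F :: "nat \<Rightarrow> 'a set"
    assume F: "range F \<subseteq> sets P" "disjoint_family F"
    have "(\<Sum>i. ennreal a * emeasure P (F i) + ennreal b * emeasure Q (F i))
        = (\<Sum>i. ennreal a * emeasure P (F i)) + (\<Sum>i. ennreal b * emeasure Q (F i))"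
      by (rule suminf_add[symmetric]) simp_all
    also have "\<dots> = ennreal a * (\<Sum>i. emeasure P (F i)) + ennreal b * (\<Sum>i. emeasure Q (F i))"
      by simp
    also have "\<dots> = ennreal a * emeasure P (\<Union>i. F i) + ennreal b * emeasure Q (\<Union>i. F i)"
      using F assms(1) by (simp add: suminf_emeasure)
    finally show "(\<Sum>i. ennreal a * emeasure P (F i) + ennreal b * emeasure Q (F i))
        = ennreal a * emeasure P (\<Union>i. F i) + ennreal b * emeasure Q (\<Union>i. F i)" .
  qed
qed

lemma prob_space_std_normal: "prob_space std_normal"
  unfolding std_normal_def by (rule prob_space_normal_density) simp

lemma measurable_matrix_normal_map:
  "(\<lambda>z. T + (A :: real^'p^'p) ** (\<chi> i j. z (i, j)) ** (B :: real^'q^'q))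
     \<in> (\<Pi>\<^sub>M (ij :: 'p \<times> 'q) \<in> UNIV. std_normal) \<rightarrow>\<^sub>M borel"
proof -
  have 1: "(\<lambda>z. (z :: 'p \<times> 'q \<Rightarrow> real) ij) \<in> (\<Pi>\<^sub>M ij \<in> UNIV. std_normal) \<rightarrow>\<^sub>M borel" for ij
  proof -
    have "(\<lambda>z. (z :: 'p \<times> 'q \<Rightarrow> real) ij) \<in> (\<Pi>\<^sub>M ij \<in> UNIV. std_normal) \<rightarrow>\<^sub>M std_normal"
      by (rule measurable_component_singleton) simp
    then show ?thesis
      by (simp add: std_normal_def)
  qed
  have "(\<lambda>z. (T + A ** (\<chi> i j. z (i, j)) ** B) \<bullet> b)
      \<in> (\<Pi>\<^sub>M (ij :: 'p \<times> 'q) \<in> UNIV. std_normal) \<rightarrow>\<^sub>M borel" for b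
    unfolding inner_vec_def matrix_matrix_mult_def using 1
    by (simp, measurable)
  then show ?thesis
    by (subst borel_measurable_euclidean_space) blast
qed

lemma prob_space_matrix_normal: "prob_space (matrix_normal T A B)"
  unfolding matrix_normal_def
  by (intro prob_space.prob_space_distr prob_space_PiM prob_space_std_normal
      measurable_matrix_normal_map)


section \<open>Sample quantities\<close>

text \<open>A sample is a sequence \<open>x 1, x 2, \<dots>\<close>; the entry \<open>x 0\<close> is not used.\<close>

definition centred :: "(nat \<Rightarrow> real^'q^'p) \<Rightarrow> nat \<Rightarrow> nat \<Rightarrow> real^'q^'p" where
  "centred x n i = x i - (1 / real n) *\<^sub>R (\<Sum>l = 1..n. x l)"

definition proj_moment :: "(nat \<Rightarrow> real^'q^'p) \<Rightarrow> nat \<Rightarrow> nat \<Rightarrow> (real^'p) \<times> (real^'q) \<Rightarrow> real" where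
  "proj_moment x n k = (\<lambda>(u, v). (1 / real n) * (\<Sum>i = 1..n. (u \<bullet> (centred x n i *v v)) ^ k))"

definition sample_kurtosis :: "(nat \<Rightarrow> real^'q^'p) \<Rightarrow> nat \<Rightarrow> (real^'p) \<times> (real^'q) \<Rightarrow> real" where
  "sample_kurtosis x n w = proj_moment x n 4 w / (proj_moment x n 2 w)\<^sup>2"

definition G1 :: "(nat \<Rightarrow> real^'q^'p) \<Rightarrow> nat \<Rightarrow> (real^'p) \<times> (real^'q) \<Rightarrow> real^'p^'p" where
  "G1 x n = (\<lambda>(u, v). (1 / real n) *\<^sub>R
     (\<Sum>i = 1..n. centred x n i ** outer v v ** transpose (centred x n i)))"

definition G2 :: "(nat \<Rightarrow> real^'q^'p) \<Rightarrow> nat \<Rightarrow> (real^'p) \<times> (real^'q) \<Rightarrow> real^'q^'q" where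
  "G2 x n = (\<lambda>(u, v). (1 / real n) *\<^sub>R
     (\<Sum>i = 1..n. transpose (centred x n i) ** outer u u ** centred x n i))"

text \<open>\<open>w 1, \<dots>, w d\<close> are the pairs \<open>(u\<^sub>1, v\<^sub>1), \<dots>, (u\<^sub>d, v\<^sub>d)\<close>; \<open>H1\<close> and \<open>H2\<close> are collections of
  matrices indexed by \<open>{1..d-1}\<close>. For \<open>j = 1\<close> the orthogonality constraints are void.\<close>
definition maximizers ::
  "(nat \<Rightarrow> real^'p^'p) \<Rightarrow> (nat \<Rightarrow> real^'q^'q) \<Rightarrow> nat \<Rightarrow> ((real^'p) \<times> (real^'q) \<Rightarrow> real)
    \<Rightarrow> (nat \<Rightarrow> (real^'p) \<times> (real^'q)) \<Rightarrow> bool" where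
  "maximizers H1 H2 d g w \<longleftrightarrow>
     (\<forall>j\<in>{1..d}. is_arg_max g
        (\<lambda>(u, v). u \<in> sphere 0 1 \<and> v \<in> sphere 0 1 \<and>
           (\<forall>k\<in>{1..<j}. u \<bullet> (H1 k *v fst (w k)) = 0 \<and> v \<bullet> (H2 k *v snd (w k)) = 0))
        (w j))"

definition kurtosis_maximizers ::
  "(nat \<Rightarrow> real^'q^'p) \<Rightarrow> nat \<Rightarrow> nat \<Rightarrow> (nat \<Rightarrow> (real^'p) \<times> (real^'q)) \<Rightarrow> bool" where
  "kurtosis_maximizers x n d w \<longleftrightarrow>
     maximizers (\<lambda>k. G1 x n (w k)) (\<lambda>k. G2 x n (w k)) d (sample_kurtosis x n) w"


section \<open>Linear discriminant coefficients\<close>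

definition theta :: "real \<Rightarrow> real \<Rightarrow> (nat \<Rightarrow> real^'q^'p) \<Rightarrow> nat \<Rightarrow> (real^'p) \<times> (real^'q) \<Rightarrow> real" where
  "theta \<alpha>\<^sub>1 \<alpha>\<^sub>2 x n w =
     sqrt (max ((sample_kurtosis x n w - 3) / (\<alpha>\<^sub>1 * \<alpha>\<^sub>2 * (1 - 6 * \<alpha>\<^sub>1 * \<alpha>\<^sub>2))) 0)"

definition lambda :: "real \<Rightarrow> real \<Rightarrow> (nat \<Rightarrow> real^'q^'p) \<Rightarrow> nat \<Rightarrow> (real^'p) \<times> (real^'q) \<Rightarrow> real" where
  "lambda \<alpha>\<^sub>1 \<alpha>\<^sub>2 x n w =
     (let \<theta> = theta \<alpha>\<^sub>1 \<alpha>\<^sub>2 x n w in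
      if 1 - \<alpha>\<^sub>1 * \<alpha>\<^sub>2 * \<theta> = 0 then 0 else sqrt (max (\<theta> / (1 - \<alpha>\<^sub>1 * \<alpha>\<^sub>2 * \<theta>)) 0))"

definition lda_sign :: "real \<Rightarrow> real \<Rightarrow> (nat \<Rightarrow> real^'q^'p) \<Rightarrow> nat \<Rightarrow> (real^'p) \<times> (real^'q) \<Rightarrow> real" where
  "lda_sign \<alpha>\<^sub>1 \<alpha>\<^sub>2 x n w = sgn (inverse (\<alpha>\<^sub>1 - \<alpha>\<^sub>2) * proj_moment x n 3 w)"

definition W_nLDA ::
  "real \<Rightarrow> real \<Rightarrow> (nat \<Rightarrow> real^'q^'p) \<Rightarrow> nat \<Rightarrow> nat \<Rightarrow> (nat \<Rightarrow> (real^'p) \<times> (real^'q)) \<Rightarrow> real^'q^'p" where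
  "W_nLDA \<alpha>\<^sub>1 \<alpha>\<^sub>2 x n d w =
     (\<Sum>j = 1..d.
        (lda_sign \<alpha>\<^sub>1 \<alpha>\<^sub>2 x n (w j) * proj_moment x n 2 (w j) powr (- 1 / 2)
          * lambda \<alpha>\<^sub>1 \<alpha>\<^sub>2 x n (w j) * sqrt (1 + \<alpha>\<^sub>1 * \<alpha>\<^sub>2 * (lambda \<alpha>\<^sub>1 \<alpha>\<^sub>2 x n (w j))\<^sup>2))
        *\<^sub>R outer (fst (w j)) (snd (w j)))"

definition W_LDA ::
  "real^'p^'p \<Rightarrow> real^'q^'q \<Rightarrow> real^'q^'p \<Rightarrow> real^'q^'p \<Rightarrow> real^'q^'p" where
  "W_LDA A B T\<^sub>1 T\<^sub>2 = matrix_inv A ** (T\<^sub>2 - T\<^sub>1) ** matrix_inv B"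

end

theory Submission
  imports Defs
begin

text \<open>Write \<open>S = A\<^sup>1\<^sup>/\<^sup>2\<close>, \<open>R = B\<^sup>1\<^sup>/\<^sup>2\<close>, \<open>D = S\<^sup>-\<^sup>1 (T\<^sub>2 - T\<^sub>1) R\<^sup>-\<^sup>1\<close> and \<open>\<beta> = \<alpha>\<^sub>1 \<alpha>\<^sub>2 < 1/6\<close>. A projection
  \<open>u \<bullet> (X - E X) v\<close> is a two-point variable with gap \<open>\<delta> = u \<bullet> (T\<^sub>2 - T\<^sub>1) v\<close> plus an independent normal variable of
  variance \<open>\<tau> = (u \<bullet> A u)(v \<bullet> B v)\<close>. With \<open>\<rho> = \<delta>\<^sup>2 / \<tau>\<close> its kurtosis is
  \<open>3 + \<beta> (1 - 6 \<beta>) (\<rho> / (1 + \<beta> \<rho>))\<^sup>2\<close>, strictly increasing in \<open>\<rho>\<close>, and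
  \<open>\<rho> = (a \<bullet> D b)\<^sup>2\<close> for the normalizations \<open>a\<close>, \<open>b\<close> of \<open>S u\<close>, \<open>R v\<close>.

  Projections of a sample are linear in its entries, so the strong law for finitely many monomials
  of the entries makes the sample moments converge along all convergent sequences of directions.
  By polarization the constraints are differences of second sample moments, hence converge as well.
  Consequently every limit point of the sample maximizers successively maximizes \<open>(a \<bullet> D b)\<^sup>2\<close>
  under orthogonality of the \<open>a\<close>'s and of the \<open>b\<close>'s, i.e. yields a singular value decomposition
  \<open>D = \<Sum>\<^sub>j \<sigma>\<^sub>j a\<^sub>j b\<^sub>j'\<close> (with signed \<open>\<sigma>\<^sub>j\<close>). The weight of \<open>u\<^sub>j v\<^sub>j'\<close> converges to \<open>\<delta> / \<tau>\<close>,
  and \<open>(\<delta> / \<tau>) u\<^sub>j v\<^sub>j' = \<sigma>\<^sub>j S\<^sup>-\<^sup>1 a\<^sub>j b\<^sub>j' R\<^sup>-\<^sup>1\<close>. As every limit point gives the same sum, the whole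
  sequence converges.\<close>

section \<open>Symmetric matrices and square roots\<close>

lemma inner_matrix_transpose: "x \<bullet> (M *v y) = (transpose M *v x) \<bullet> y" for M :: "real^'n^'m"
  by (simp add: dot_lmul_matrix)

lemma outer_vector_mult: "outer u v *v y = (v \<bullet> y) *\<^sub>R u"
  by (simp add: vec_eq_iff matrix_vector_mult_def outer_def inner_vec_def sum_distrib_left
      sum_distrib_right ac_simps)

lemma sum_matrix_vector_mult: "(\<Sum>k\<in>K. f k) *v y = (\<Sum>k\<in>K. f k *v y)"
  for f :: "'k \<Rightarrow> real^'n^'m"
  by (induction K rule: infinite_finite_induct) (simp_all add: matrix_vector_mult_add_rdistrib)

text \<open>A first-order optimality condition without derivatives: a linear term dominated by a
  quadratic one for every \<open>t\<close> has to vanish. For \<open>c > 0\<close> the choice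
  \<open>t = a / c\<close> gives \<open>2 * a^2 \<le> a^2\<close>.\<close>

lemma nonneg_eq_0_if_quadratic_bound:
  fixes a c :: real
  assumes "a \<ge> 0" and "\<And>t. 2 * t * a \<le> t\<^sup>2 * c"
  shows "a = 0"
proof (cases "c \<le> 0")
  case True
  then show ?thesis using assms(1) assms(2)[of 1] by simp
next
  case False
  then have "2 * (a / c) * a \<le> (a / c)\<^sup>2 * c" using assms(2) by blast
  then have "2 * a\<^sup>2 \<le> a\<^sup>2" using False by (simp add: field_simps power2_eq_square)
  then show ?thesis by simp
qed

text \<open>A maximizer \<open>x\<close> of the Rayleigh quotient exists on the compact unit sphere
  of \<open>V\<close>. It is an eigenvector because its residual is an admissible direction of
  perturbation.\<close>

lemma symmetric_eigenvector_maximum: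
  fixes M :: "real^'n^'n"
  assumes sym: "transpose M = M" and V: "subspace V" and inv: "\<And>x. x \<in> V \<Longrightarrow> M *v x \<in> V"
    and ne: "V \<noteq> {0}"
  obtains x where "x \<in> V" "norm x = 1" "M *v x = (x \<bullet> (M *v x)) *\<^sub>R x"
    "\<And>y. y \<in> V \<Longrightarrow> y \<bullet> (M *v y) \<le> (x \<bullet> (M *v x)) * (norm y)\<^sup>2"
proof -
  let ?q = "\<lambda>y. y \<bullet> (M *v y)"
  have "0 \<in> V" using V subspace_0 by blast
  with ne obtain z where z: "z \<in> V" "z \<noteq> 0" by auto
  have "compact (sphere 0 1 \<inter> V)"
    using closed_subspace[OF V] by (intro compact_Int_closed) auto
  moreover have "sphere 0 1 \<inter> V \<noteq> {}"
  proof -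
    have "z /\<^sub>R norm z \<in> sphere 0 1 \<inter> V" using z V by (simp add: subspace_scale)
    then show ?thesis by blast
  qed
  moreover have "continuous_on (sphere 0 1 \<inter> V) ?q"
    by (intro continuous_intros linear_continuous_on matrix_vector_mul_bounded_linear)
  ultimately obtain x where "x \<in> sphere 0 1 \<inter> V"
    and max: "\<And>y. y \<in> sphere 0 1 \<inter> V \<Longrightarrow> ?q y \<le> ?q x"
    using continuous_attains_sup[of "sphere 0 1 \<inter> V" ?q] by blast
  then have x: "x \<in> V" "norm x = 1" by auto
  have bound: "?q y \<le> ?q x * (norm y)\<^sup>2" if y: "y \<in> V" for y
  proof (cases "y = 0")
    case False
    then have "?q (y /\<^sub>R norm y) \<le> ?q x" using y V by (intro max) (simp add: subspace_scale)
    moreover have "?q (y /\<^sub>R norm y) = ?q y / (norm y)\<^sup>2"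
      by (simp add: matrix_vector_mult_scaleR power2_eq_square field_simps)
    ultimately show ?thesis using False by (simp add: divide_le_eq)
  qed simp
  \<comment> \<open>The residual lies in \<open>V\<close> by invariance and is orthogonal to
    \<open>x\<close>. In the Rayleigh bound at \<open>x + t *\<^sub>R w\<close> the term linear in
    \<open>t\<close> is \<open>2 * t * (w \<bullet> w)\<close>, which forces
    \<open>w = 0\<close>.\<close>
  define w where "w = M *v x - ?q x *\<^sub>R x"
  have xx: "x \<bullet> x = 1" using x(2) by (simp add: dot_square_norm)
  have wV: "w \<in> V" unfolding w_def by (intro subspace_diff subspace_scale V inv x)
  have xw: "x \<bullet> w = 0" unfolding w_def by (simp add: inner_diff_right xx)
  have wMx: "w \<bullet> (M *v x) = w \<bullet> w"
  proof -
    have "w \<bullet> (M *v x) = w \<bullet> (w + ?q x *\<^sub>R x)" by (simp add: w_def)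
    then show ?thesis using xw by (simp add: inner_add_right inner_commute)
  qed
  have xMw: "x \<bullet> (M *v w) = w \<bullet> w"
    using wMx sym by (metis inner_commute inner_matrix_transpose)
  have "w \<bullet> w = 0"
  proof (rule nonneg_eq_0_if_quadratic_bound)
    fix t :: real
    have "?q (x + t *\<^sub>R w) \<le> ?q x * (norm (x + t *\<^sub>R w))\<^sup>2"
      by (intro bound subspace_add subspace_scale V x wV)
    moreover have "(norm (x + t *\<^sub>R w))\<^sup>2 = 1 + t\<^sup>2 * (w \<bullet> w)"
      unfolding power2_norm_eq_inner
      by (simp add: inner_add_left inner_add_right xx xw inner_commute[of w x] power2_eq_square)
    moreover have "?q (x + t *\<^sub>R w) = ?q x + 2 * t * (w \<bullet> w) + t\<^sup>2 * ?q w"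
      by (simp add: matrix_vector_right_distrib matrix_vector_mult_scaleR inner_add_left
          inner_add_right wMx xMw power2_eq_square algebra_simps)
    ultimately show "2 * t * (w \<bullet> w) \<le> t\<^sup>2 * (?q x * (w \<bullet> w) - ?q w)"
      by (simp add: algebra_simps)
  qed simp
  then have "M *v x = ?q x *\<^sub>R x" by (simp add: w_def)
  with x bound show ?thesis using that by blast
qed

text \<open>Induction on the dimension: split off one unit eigenvector; by symmetry its orthogonal
  complement within \<open>V\<close> is again invariant. Invariant subspaces appear in the statement
  for the sake of this induction.\<close>

lemma symmetric_orthonormal_eigenbasis_subspace:
  fixes M :: "real^'n^'n"
  assumes sym: "transpose M = M" and "subspace V" and "\<And>x. x \<in> V \<Longrightarrow> M *v x \<in> V"
  shows "\<exists>E \<subseteq> V. finite E \<and> pairwise orthogonal E \<and> V \<subseteq> span E \<and>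
           (\<forall>e\<in>E. norm e = 1 \<and> M *v e = (e \<bullet> (M *v e)) *\<^sub>R e)"
  using assms(2,3)
proof (induction "dim V" arbitrary: V rule: less_induct)
  case less
  show ?case
  proof (cases "V = {0}")
    case True
    then show ?thesis by (intro exI[of _ "{}"]) (auto simp: pairwise_def)
  next
    case False
    then obtain x where x: "x \<in> V" "norm x = 1" "M *v x = (x \<bullet> (M *v x)) *\<^sub>R x"
      using symmetric_eigenvector_maximum[OF sym less.prems(1)] less.prems(2) by metis
    define V' where "V' = {y \<in> V. x \<bullet> y = 0}"
    have V': "subspace V'"
      using less.prems(1) unfolding V'_def subspace_def by (auto simp: inner_add_right)
    have inv': "M *v y \<in> V'" if "y \<in> V'" for y
    proof -
      have "x \<bullet> (M *v y) = (M *v x) \<bullet> y" by (metis inner_matrix_transpose sym)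
      also have "\<dots> = 0" using that by (subst x(3)) (simp add: V'_def)
      finally show ?thesis using that less.prems(2) by (simp add: V'_def)
    qed
    have xx: "x \<bullet> x = 1" using x(2) by (simp add: dot_square_norm)
    have "x \<notin> V'" using xx by (simp add: V'_def)
    moreover have "V' \<subseteq> V" by (auto simp: V'_def)
    ultimately have "V' \<subset> V" using x(1) by blast
    then have "dim V' < dim V"
      using V' less.prems(1) by (simp add: dim_psubset span_eq_iff[THEN iffD2])
    from less.hyps[OF this V' inv'] obtain E where E: "E \<subseteq> V'" "finite E" "pairwise orthogonal E"
      "V' \<subseteq> span E" "\<forall>e\<in>E. norm e = 1 \<and> M *v e = (e \<bullet> (M *v e)) *\<^sub>R e" by blast
    have "V \<subseteq> span (insert x E)"
    proof
      fix y assume "y \<in> V"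
      then have "y - (x \<bullet> y) *\<^sub>R x \<in> V'"
        using less.prems(1) x(1) xx by (simp add: V'_def subspace_diff subspace_scale inner_diff_right)
      then show "y \<in> span (insert x E)" using E(4) by (auto simp: span_insert)
    qed
    moreover have "pairwise orthogonal (insert x E)"
      using E(1,3) by (auto simp: pairwise_insert V'_def orthogonal_def inner_commute)
    moreover have "insert x E \<subseteq> V" using E(1) x(1) by (auto simp: V'_def)
    moreover have "\<forall>e\<in>insert x E. norm e = 1 \<and> M *v e = (e \<bullet> (M *v e)) *\<^sub>R e"
      using E(5) x(2,3) by blast
    ultimately show ?thesis using E(2) by blast
  qed
qed

lemma symmetric_orthonormal_eigenbasis:
  fixes M :: "real^'n^'n"
  assumes "transpose M = M"
  obtains E where "finite E" "pairwise orthogonal E" "span E = UNIV" "\<And>e. e \<in> E \<Longrightarrow> norm e = 1"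
    "\<And>e. e \<in> E \<Longrightarrow> M *v e = (e \<bullet> (M *v e)) *\<^sub>R e"
proof -
  obtain E where E: "finite E" "pairwise orthogonal E" "UNIV \<subseteq> span E"
    "\<forall>e\<in>E. norm e = 1 \<and> M *v e = (e \<bullet> (M *v e)) *\<^sub>R e"
    using symmetric_orthonormal_eigenbasis_subspace[OF assms subspace_UNIV UNIV_I] by blast
  then have "span E = UNIV" by blast
  with E that show thesis by blast
qed

lemma symmetric_eq_0_if_eigenvalues_0:
  fixes M :: "real^'n^'n"
  assumes "transpose M = M" and "\<And>x c. norm x = 1 \<Longrightarrow> M *v x = c *\<^sub>R x \<Longrightarrow> c = 0"
  shows "M = 0"
proof -
  obtain E where E: "span E = UNIV" "\<And>e. e \<in> E \<Longrightarrow> norm e = 1"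
    "\<And>e. e \<in> E \<Longrightarrow> M *v e = (e \<bullet> (M *v e)) *\<^sub>R e"
    using symmetric_orthonormal_eigenbasis[OF assms(1)] by metis
  have "M *v e = 0" if "e \<in> E" for e
    using assms(2)[OF E(2,3)[OF that]] E(3)[OF that] by (metis scaleR_zero_left)
  then have "M *v x = 0" for x
    using linear_eq_0_on_span[OF matrix_vector_mul_linear, of E M x] E(1) by simp
  then show ?thesis by (simp add: matrix_eq)
qed

text \<open>On an orthonormal eigenbasis the root multiplies each eigenvector by the square root of
  its eigenvalue; \<open>s\<close> is this map, written through the expansion of \<open>x\<close> in
  the basis.\<close>

lemma sym_pos_def_sqrt_exists:
  fixes M :: "real^'n^'n"
  assumes "sym_pos_def M"
  shows "\<exists>S. sym_pos_def S \<and> S ** S = M"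
proof -
  have sym: "transpose M = M" and pos: "\<And>x. x \<noteq> 0 \<Longrightarrow> x \<bullet> (M *v x) > 0"
    using assms by (auto simp: sym_pos_def_def)
  obtain E where E: "finite E" "pairwise orthogonal E" "span E = UNIV" "\<And>e. e \<in> E \<Longrightarrow> norm e = 1"
    "\<And>e. e \<in> E \<Longrightarrow> M *v e = (e \<bullet> (M *v e)) *\<^sub>R e"
    using symmetric_orthonormal_eigenbasis[OF sym] by metis
  define l where "l e = e \<bullet> (M *v e)" for e
  have Me: "M *v e = l e *\<^sub>R e" if "e \<in> E" for e
    unfolding l_def by (rule E(5)[OF that])
  have l: "l e > 0" if "e \<in> E" for e unfolding l_def using E(4)[OF that] by (intro pos) auto
  define s where "s x = (\<Sum>e\<in>E. (sqrt (l e) * (x \<bullet> e)) *\<^sub>R e)" for x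
  have "linear s"
    unfolding s_def by (intro linearI)
      (simp_all add: inner_add_left algebra_simps sum.distrib scaleR_sum_right)
  then have S: "matrix s *v x = s x" for x by (simp add: matrix_works)
  have expand: "(\<Sum>e\<in>E. (x \<bullet> e) *\<^sub>R e) = x" for x
    using E by (intro orthonormal_basis_expand) auto
  have s_inner: "s x \<bullet> y = (\<Sum>e\<in>E. sqrt (l e) * (x \<bullet> e) * (y \<bullet> e))" for x y
    unfolding s_def by (subst inner_commute) (simp add: inner_sum_right)
  have "transpose (matrix s) = matrix s"
  proof -
    have "(transpose (matrix s) *v x) \<bullet> y = (matrix s *v x) \<bullet> y" for x y
    proof -
      have "(transpose (matrix s) *v x) \<bullet> y = x \<bullet> s y" by (metis S inner_matrix_transpose)
      also have "\<dots> = s y \<bullet> x" by (rule inner_commute)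
      also have "\<dots> = s x \<bullet> y" unfolding s_inner by (intro sum.cong refl) (simp add: mult.assoc mult.commute)
      finally show ?thesis by (simp add: S)
    qed
    then have "transpose (matrix s) *v x = matrix s *v x" for x
      using vector_eq_rdot[of "transpose (matrix s) *v x" "matrix s *v x"] by blast
    then show ?thesis unfolding matrix_eq by blast
  qed
  moreover have "x \<bullet> (matrix s *v x) > 0" if "x \<noteq> 0" for x
  proof -
    have "\<exists>e\<in>E. x \<bullet> e \<noteq> 0"
    proof (rule ccontr)
      assume "\<not> (\<exists>e\<in>E. x \<bullet> e \<noteq> 0)"
      then have "(\<Sum>e\<in>E. (x \<bullet> e) *\<^sub>R e) = 0" by (intro sum.neutral) auto
      then show False using expand[of x] that by simp
    qed
    then obtain e where e: "e \<in> E" "x \<bullet> e \<noteq> 0" by blast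
    have "sqrt (l e) * (x \<bullet> e) * (x \<bullet> e) \<ge> 0" if "e \<in> E" for e
      using l[OF that] by (simp add: mult.assoc)
    moreover have "sqrt (l e) * (x \<bullet> e) * (x \<bullet> e) > 0"
    proof -
      have "(x \<bullet> e) * (x \<bullet> e) > 0" using e(2) not_real_square_gt_zero by blast
      then show ?thesis unfolding mult.assoc using l[OF e(1)] by (intro mult_pos_pos[of "sqrt (l e)"]) simp_all
    qed
    ultimately have "(\<Sum>e\<in>E. sqrt (l e) * (x \<bullet> e) * (x \<bullet> e)) > 0"
      using E(1) e(1) by (intro sum_pos2)
    then show ?thesis unfolding S by (subst inner_commute) (simp only: s_inner)
  qed
  moreover have "matrix s ** matrix s = M"
  proof -
    have ee: "e \<bullet> e' = (if e = e' then 1 else 0)" if "e \<in> E" "e' \<in> E" for e e'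
      using E(2,4) that by (auto simp: pairwise_def orthogonal_def dot_square_norm)
    have "s x \<bullet> e = sqrt (l e) * (x \<bullet> e)" if "e \<in> E" for x e
      unfolding s_inner using that E(1) by (simp add: ee if_distrib sum.If_cases cong: if_cong sum.cong)
    then have "s (s x) = (\<Sum>e\<in>E. (x \<bullet> e) *\<^sub>R (l e *\<^sub>R e))" for x
      unfolding s_def[of "s x"] using l by (intro sum.cong) (auto simp: less_imp_le)
    also have "\<dots> x = M *v (\<Sum>e\<in>E. (x \<bullet> e) *\<^sub>R e)" for x
      by (simp add: linear_sum[OF matrix_vector_mul_linear] matrix_vector_mult_scaleR Me cong: sum.cong)
    finally have "(matrix s ** matrix s) *v x = M *v x" for x
      by (simp add: S expand flip: matrix_vector_mul_assoc)
    then show ?thesis by (simp add: matrix_eq)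
  qed
  ultimately show ?thesis unfolding sym_pos_def_def by blast
qed

text \<open>The difference is symmetric, so it suffices that its eigenvalues vanish. An eigenvalue
  \<open>c\<close> with eigenvector \<open>x\<close> satisfies
  \<open>c * (x \<bullet> (S *v x) + x \<bullet> (R *v x)) = 0\<close>, and positive definiteness
  makes the second factor positive.\<close>

lemma sym_pos_def_sqrt_unique:
  fixes S R :: "real^'n^'n"
  assumes S: "sym_pos_def S" and R: "sym_pos_def R" and eq: "S ** S = R ** R"
  shows "S = R"
proof -
  have symS: "transpose S = S" and symR: "transpose R = R" using S R by (auto simp: sym_pos_def_def)
  have symD: "transpose (S - R) = S - R" using symS symR by (simp add: transpose_def vec_eq_iff)
  then have "S - R = 0"
  proof (rule symmetric_eq_0_if_eigenvalues_0)
    fix x c assume x: "norm x = 1" "(S - R) *v x = c *\<^sub>R x"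
    \<comment> \<open>\<open>S (S - R) + (S - R) R = 0\<close>, evaluated at an eigenvector of \<open>S - R\<close>\<close>
    have "S *v ((S - R) *v x) + (S - R) *v (R *v x) = (S ** S) *v x - (R ** R) *v x"
      by (simp add: matrix_vector_mult_diff_rdistrib matrix_vector_mult_diff_distrib
          flip: matrix_vector_mul_assoc)
    then have "0 = x \<bullet> (S *v ((S - R) *v x)) + x \<bullet> ((S - R) *v (R *v x))"
      using eq by (simp flip: inner_add_right)
    also have "x \<bullet> ((S - R) *v (R *v x)) = ((S - R) *v x) \<bullet> (R *v x)"
      by (metis inner_matrix_transpose symD)
    finally have "0 = x \<bullet> (S *v (c *\<^sub>R x)) + (c *\<^sub>R x) \<bullet> (R *v x)"
      by (simp only: x(2))
    then have "c * (x \<bullet> (S *v x) + x \<bullet> (R *v x)) = 0"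
      by (simp add: matrix_vector_mult_scaleR algebra_simps)
    moreover have "x \<noteq> 0" using x(1) by auto
    then have "x \<bullet> (S *v x) + x \<bullet> (R *v x) > 0"
      using S R unfolding sym_pos_def_def by (intro add_pos_pos) blast+
    ultimately show "c = 0" by simp
  qed
  then show ?thesis by simp
qed

text \<open>Existence and uniqueness together resolve the definite description in
  \<open>mat_sqrt\<close>.\<close>

lemma mat_sqrt:
  assumes "sym_pos_def M"
  shows "sym_pos_def (mat_sqrt M)" "mat_sqrt M ** mat_sqrt M = M"
proof -
  have "\<exists>!S. sym_pos_def S \<and> S ** S = M"
    using sym_pos_def_sqrt_exists[OF assms] sym_pos_def_sqrt_unique by metis
  then have "sym_pos_def (mat_sqrt M) \<and> mat_sqrt M ** mat_sqrt M = M"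
    unfolding mat_sqrt_def by (rule theI')
  then show "sym_pos_def (mat_sqrt M)" "mat_sqrt M ** mat_sqrt M = M" by auto
qed

section \<open>Inverse matrices and outer products\<close>

lemma sym_pos_def_invertible: "invertible M" if "sym_pos_def M" for M :: "real^'n^'n"
proof -
  have "x = 0" if "M *v x = 0" for x
  proof (rule ccontr)
    assume "x \<noteq> 0"
    then have "x \<bullet> (M *v x) > 0" using \<open>sym_pos_def M\<close> by (simp add: sym_pos_def_def)
    then show False using that by simp
  qed
  then show ?thesis by (simp add: invertible_left_inverse matrix_left_invertible_ker)
qed

lemma matrix_inv_mult:
  fixes S :: "real^'n^'n"
  assumes "invertible S"
  shows "S ** matrix_inv S = mat 1" "matrix_inv S ** S = mat 1"
proof -
  have "S ** matrix_inv S = mat 1 \<and> matrix_inv S ** S = mat 1"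
    using assms unfolding invertible_def matrix_inv_def by (rule someI_ex)
  then show "S ** matrix_inv S = mat 1" "matrix_inv S ** S = mat 1" by auto
qed

lemma matrix_inv_unique:
  fixes S :: "real^'n^'n"
  assumes "S ** P = mat 1"
  shows "matrix_inv S = P"
proof -
  have "invertible S" using assms by (auto simp: invertible_right_inverse)
  then have "matrix_inv S = matrix_inv S ** (S ** P)" by (simp add: assms)
  also have "\<dots> = P" using matrix_inv_mult[OF \<open>invertible S\<close>] by (simp add: matrix_mul_assoc)
  finally show ?thesis .
qed

lemma matrix_mult_outer_mult:
  fixes P :: "real^'p^'p" and Q :: "real^'q^'q"
  shows "P ** outer a b ** Q = outer (P *v a) (transpose Q *v b)"
  by (simp add: matrix_eq outer_vector_mult matrix_vector_mult_scaleR dot_lmul_matrix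
      flip: matrix_vector_mul_assoc)

lemma sum_matrix_mult_left: "P ** (\<Sum>k\<in>K. f k) = (\<Sum>k\<in>K. P ** f k)" for P :: "real^'n^'m"
  by (induction K rule: infinite_finite_induct) (simp_all add: matrix_add_ldistrib)

lemma sum_matrix_mult_right: "(\<Sum>k\<in>K. f k) ** P = (\<Sum>k\<in>K. f k ** P)" for P :: "real^'n^'m"
  by (induction K rule: infinite_finite_induct) (simp_all add: matrix_matrix_mult_def vec_eq_iff sum.distrib distrib_right)

section \<open>Variational singular value decomposition\<close>

text \<open>The equality case of Cauchy-Schwarz: among unit vectors the inner product with
  \<open>w\<close> is largest in absolute value at the normalization of \<open>w\<close>. If
  \<open>b\<close> does as well, the component of \<open>w\<close> orthogonal to \<open>b\<close>
  has norm 0.\<close>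

lemma scaleR_eq_if_inner_maximal:
  fixes w b :: "'a::real_inner"
  assumes b: "norm b = 1" and max: "w \<noteq> 0 \<Longrightarrow> (w \<bullet> (w /\<^sub>R norm w))\<^sup>2 \<le> (w \<bullet> b)\<^sup>2"
  shows "w = (w \<bullet> b) *\<^sub>R b"
proof (cases "w = 0")
  case False
  have bb: "b \<bullet> b = 1" using b by (simp add: dot_square_norm)
  have "w \<bullet> (w /\<^sub>R norm w) = norm w"
    using False by (simp add: dot_square_norm power2_eq_square)
  then have "w \<bullet> w \<le> (w \<bullet> b)\<^sup>2" using max[OF False] by (simp add: dot_square_norm)
  moreover have "(w - (w \<bullet> b) *\<^sub>R b) \<bullet> (w - (w \<bullet> b) *\<^sub>R b) = w \<bullet> w - (w \<bullet> b)\<^sup>2"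
    by (simp add: inner_diff_left inner_diff_right bb inner_commute[of b w] power2_eq_square)
  ultimately have "(w - (w \<bullet> b) *\<^sub>R b) \<bullet> (w - (w \<bullet> b) *\<^sub>R b) \<le> 0" by simp
  then have "w - (w \<bullet> b) *\<^sub>R b = 0" by (metis inner_eq_zero_iff inner_ge_zero order_antisym)
  then show ?thesis by simp
qed simp

lemma orthonormal_residual_orthogonal:
  fixes b :: "'k \<Rightarrow> 'a::real_inner"
  assumes "finite K" "k \<in> K"
    and b: "\<And>k. k \<in> K \<Longrightarrow> norm (b k) = 1" "\<And>k l. k \<in> K \<Longrightarrow> l \<in> K \<Longrightarrow> k \<noteq> l \<Longrightarrow> b k \<bullet> b l = 0"
  shows "b k \<bullet> (y - (\<Sum>l\<in>K. (b l \<bullet> y) *\<^sub>R b l)) = 0"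
proof -
  have "(\<Sum>l\<in>K. (b l \<bullet> y) * (b k \<bullet> b l)) = (\<Sum>l\<in>K. if l = k then b k \<bullet> y else 0)"
    using b \<open>k \<in> K\<close> by (intro sum.cong) (auto simp: dot_square_norm)
  then show ?thesis
    using assms(1,2) by (simp add: inner_diff_right inner_sum_right)
qed

lemma residual_image:
  fixes M :: "real^'q^'p"
  assumes "\<And>k. k \<in> K \<Longrightarrow> M *v b k = s k *\<^sub>R a k"
  shows "M *v (y - (\<Sum>l\<in>K. (b l \<bullet> y) *\<^sub>R b l)) = M *v y - (\<Sum>l\<in>K. (s l * (b l \<bullet> y)) *\<^sub>R a l)"
  by (simp add: matrix_vector_mult_diff_distrib linear_sum[OF matrix_vector_mul_linear]
      matrix_vector_mult_scaleR assms mult.commute)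

text \<open>One step of the variational construction of a singular value decomposition: the maximizer
  of \<open>(a \<bullet> M b)\<^sup>2\<close> orthogonal to previously found singular pairs is a singular pair, because
  \<open>M b\<close> is itself orthogonal to the previous left singular vectors and hence an admissible
  direction, so that the Cauchy-Schwarz inequality is attained.\<close>
lemma singular_pair_step:
  fixes M :: "real^'q^'p"
  assumes K: "finite K" "card K < rank M"
    and aK: "\<And>k. k \<in> K \<Longrightarrow> norm (a k) = 1" "\<And>k l. k \<in> K \<Longrightarrow> l \<in> K \<Longrightarrow> k \<noteq> l \<Longrightarrow> a k \<bullet> a l = 0"
    and bK: "\<And>k. k \<in> K \<Longrightarrow> norm (b k) = 1" "\<And>k l. k \<in> K \<Longrightarrow> l \<in> K \<Longrightarrow> k \<noteq> l \<Longrightarrow> b k \<bullet> b l = 0"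
    and Mb: "\<And>k. k \<in> K \<Longrightarrow> M *v b k = s k *\<^sub>R a k"
    and Mt: "\<And>k. k \<in> K \<Longrightarrow> transpose M *v a k = s k *\<^sub>R b k"
    and x: "norm x = 1" "\<And>k. k \<in> K \<Longrightarrow> x \<bullet> a k = 0"
    and y: "norm y = 1" "\<And>k. k \<in> K \<Longrightarrow> y \<bullet> b k = 0"
    and max: "\<And>x' y'. norm x' = 1 \<Longrightarrow> norm y' = 1 \<Longrightarrow> (\<And>k. k \<in> K \<Longrightarrow> x' \<bullet> a k = 0) \<Longrightarrow>
       (\<And>k. k \<in> K \<Longrightarrow> y' \<bullet> b k = 0) \<Longrightarrow> (x' \<bullet> (M *v y'))\<^sup>2 \<le> (x \<bullet> (M *v y))\<^sup>2"
  shows "M *v y = (x \<bullet> (M *v y)) *\<^sub>R x" "transpose M *v x = (x \<bullet> (M *v y)) *\<^sub>R y"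
    "x \<bullet> (M *v y) \<noteq> 0"
proof -
  let ?w = "M *v y" and ?z = "transpose M *v x"
  have w: "?w \<bullet> a k = 0" if "k \<in> K" for k
  proof -
    have "a k \<bullet> ?w = (transpose M *v a k) \<bullet> y" by (rule inner_matrix_transpose)
    then show ?thesis using y(2)[OF that] unfolding Mt[OF that] by (simp add: inner_commute)
  qed
  have z: "?z \<bullet> b k = 0" if "k \<in> K" for k
  proof -
    have "?z \<bullet> b k = x \<bullet> (M *v b k)" by (rule inner_matrix_transpose[symmetric])
    then show ?thesis using x(2)[OF that] unfolding Mb[OF that] by simp
  qed
  have "?w = (?w \<bullet> x) *\<^sub>R x"
  proof (rule scaleR_eq_if_inner_maximal[OF x(1)])
    assume "?w \<noteq> 0"
    then show "(?w \<bullet> (?w /\<^sub>R norm ?w))\<^sup>2 \<le> (?w \<bullet> x)\<^sup>2"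
      using max[of "?w /\<^sub>R norm ?w" y] y w by (simp add: inner_commute)
  qed
  then show 1: "M *v y = (x \<bullet> (M *v y)) *\<^sub>R x" by (simp add: inner_commute)
  have zy: "x \<bullet> (M *v y') = ?z \<bullet> y'" for y' by (rule inner_matrix_transpose)
  have "?z = (?z \<bullet> y) *\<^sub>R y"
  proof (rule scaleR_eq_if_inner_maximal[OF y(1)])
    assume "?z \<noteq> 0"
    then have "norm (?z /\<^sub>R norm ?z) = 1" by simp
    then show "(?z \<bullet> (?z /\<^sub>R norm ?z))\<^sup>2 \<le> (?z \<bullet> y)\<^sup>2"
      unfolding zy[symmetric] using max[of x "?z /\<^sub>R norm ?z"] x z by simp
  qed
  then show "transpose M *v x = (x \<bullet> (M *v y)) *\<^sub>R y" unfolding zy .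
  \<comment> \<open>If the maximum were 0, then \<open>M\<close> would vanish on the orthogonal
    complement of the \<open>b k\<close>: a vector \<open>r\<close> there with
    \<open>M *v r \<noteq> 0\<close> would make the normalizations of \<open>M *v r\<close> and
    \<open>r\<close> an admissible pair with a positive value. The range of \<open>M\<close> would
    then be spanned by the \<open>a k\<close>, which are fewer than its rank.\<close>
  show "x \<bullet> (M *v y) \<noteq> 0"
  proof
    assume 0: "x \<bullet> (M *v y) = 0"
    have "M *v y' \<in> span (a ` K)" for y'
    proof -
      define r where "r = y' - (\<Sum>l\<in>K. (b l \<bullet> y') *\<^sub>R b l)"
      have rb: "b k \<bullet> r = 0" if "k \<in> K" for k
        unfolding r_def using orthonormal_residual_orthogonal[of K k b y'] K(1) that bK by blast
      have Mr: "M *v r = M *v y' - (\<Sum>l\<in>K. (s l * (b l \<bullet> y')) *\<^sub>R a l)"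
        unfolding r_def using residual_image[of K M b s a y'] Mb by blast
      have "M *v r = 0"
      proof (rule ccontr)
        assume Mr0: "M *v r \<noteq> 0"
        then have r0: "r \<noteq> 0" by auto
        have "(M *v r) \<bullet> a k = 0" if "k \<in> K" for k
        proof -
          have "a k \<bullet> (M *v r) = (transpose M *v a k) \<bullet> r" by (rule inner_matrix_transpose)
          then show ?thesis using rb[OF that] unfolding Mt[OF that] by (simp add: inner_commute)
        qed
        then have "(((M *v r) /\<^sub>R norm (M *v r)) \<bullet> (M *v (r /\<^sub>R norm r)))\<^sup>2 \<le> (x \<bullet> (M *v y))\<^sup>2"
          using Mr0 r0 rb by (intro max) (simp_all add: inner_commute)
        then show False using Mr0 r0 0 by (simp add: matrix_vector_mult_scaleR)
      qed
      then have "M *v y' = (\<Sum>l\<in>K. (s l * (b l \<bullet> y')) *\<^sub>R a l)" using Mr by simp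
      then show ?thesis by (simp add: span_sum span_scale span_base)
    qed
    then have "rank M \<le> dim (a ` K)"
      unfolding rank_dim_range by (intro dim_mono) auto
    also have "\<dots> \<le> card (a ` K)" using K(1) by (intro dim_le_card') auto
    also have "\<dots> \<le> card K" using K(1) by (rule card_image_le)
    finally show False using K(2) by simp
  qed
qed

text \<open>As many singular pairs as the rank leave nothing over: if
  \<open>M *v r \<noteq> 0\<close> for some \<open>r\<close> orthogonal to all \<open>b k\<close>,
  then \<open>M *v r\<close> and the \<open>a k\<close> would be \<open>rank M + 1\<close> nonzero
  orthogonal vectors in the range. The \<open>a k\<close> lie in the range because
  \<open>s k \<noteq> 0\<close>.\<close>

lemma singular_value_decomposition_complete:
  fixes M :: "real^'q^'p"
  assumes K: "finite K" "card K = rank M"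
    and aK: "\<And>k. k \<in> K \<Longrightarrow> norm (a k) = 1" "\<And>k l. k \<in> K \<Longrightarrow> l \<in> K \<Longrightarrow> k \<noteq> l \<Longrightarrow> a k \<bullet> a l = 0"
    and bK: "\<And>k. k \<in> K \<Longrightarrow> norm (b k) = 1" "\<And>k l. k \<in> K \<Longrightarrow> l \<in> K \<Longrightarrow> k \<noteq> l \<Longrightarrow> b k \<bullet> b l = 0"
    and Mb: "\<And>k. k \<in> K \<Longrightarrow> M *v b k = s k *\<^sub>R a k"
    and Mt: "\<And>k. k \<in> K \<Longrightarrow> transpose M *v a k = s k *\<^sub>R b k"
    and s: "\<And>k. k \<in> K \<Longrightarrow> s k \<noteq> 0"
  shows "M = (\<Sum>k\<in>K. s k *\<^sub>R outer (a k) (b k))"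
proof -
  have Mr0: "M *v r = 0" if rb: "\<And>k. k \<in> K \<Longrightarrow> b k \<bullet> r = 0" for r
  proof (rule ccontr)
    assume 0: "M *v r \<noteq> 0"
    have orth: "(M *v r) \<bullet> a k = 0" if "k \<in> K" for k
    proof -
      have "a k \<bullet> (M *v r) = (transpose M *v a k) \<bullet> r" by (rule inner_matrix_transpose)
      then show ?thesis using rb[OF that] unfolding Mt[OF that] by (simp add: inner_commute)
    qed
    have inj: "inj_on a K"
    proof (rule inj_onI, rule ccontr)
      fix k l assume "k \<in> K" "l \<in> K" "a k = a l" "k \<noteq> l"
      then have "a k \<bullet> a k = 0" using aK(2)[of k l] by simp
      then show False using aK(1)[OF \<open>k \<in> K\<close>] by simp
    qed
    have notin: "M *v r \<notin> a ` K"
    proof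
      assume "M *v r \<in> a ` K"
      then obtain k where "k \<in> K" "M *v r = a k" by blast
      then show False using orth[of k] 0 by simp
    qed
    have "a k \<in> range ((*v) M)" if "k \<in> K" for k
    proof -
      have "M *v ((1 / s k) *\<^sub>R b k) = a k"
        using Mb[OF that] s[OF that] by (simp add: matrix_vector_mult_scaleR)
      then show ?thesis by (metis rangeI)
    qed
    then have sub: "insert (M *v r) (a ` K) \<subseteq> range ((*v) M)" by auto
    have "pairwise orthogonal (insert (M *v r) (a ` K))"
      using aK(2) orth by (auto simp: pairwise_insert pairwise_image pairwise_def orthogonal_def inner_commute)
    moreover have "0 \<notin> insert (M *v r) (a ` K)" using 0 aK(1) by (metis image_iff insert_iff norm_zero zero_neq_one)
    ultimately have "independent (insert (M *v r) (a ` K))"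
      by (rule pairwise_orthogonal_independent)
    then have "card (insert (M *v r) (a ` K)) \<le> dim (range ((*v) M))"
      using sub independent_card_le_dim by blast
    then show False
      using K notin by (simp add: rank_dim_range card_image[OF inj])
  qed
  have "M *v y = (\<Sum>k\<in>K. s k *\<^sub>R outer (a k) (b k)) *v y" for y
  proof -
    let ?r = "y - (\<Sum>l\<in>K. (b l \<bullet> y) *\<^sub>R b l)"
    have "M *v ?r = 0"
      using K(1) bK by (intro Mr0 orthonormal_residual_orthogonal)
    then have "M *v y = (\<Sum>l\<in>K. (s l * (b l \<bullet> y)) *\<^sub>R a l)"
      using residual_image[of K M b s a y] Mb by simp
    also have "\<dots> = (\<Sum>k\<in>K. s k *\<^sub>R outer (a k) (b k)) *v y"
      by (simp add: sum_matrix_vector_mult outer_vector_mult flip: scaleR_matrix_vector_assoc)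
    finally show ?thesis .
  qed
  then show ?thesis by (simp add: matrix_eq)
qed

section \<open>A strong law of large numbers\<close>

text \<open>Lower powers are dominated by \<open>1 + Y^4\<close>, which is integrable over a finite
  measure.\<close>

lemma integrable_power_le_4:
  fixes Y :: "'a \<Rightarrow> real"
  assumes "finite_measure M" and Y: "Y \<in> borel_measurable M"
    and int: "integrable M (\<lambda>\<omega>. Y \<omega> ^ 4)" and "j \<le> 4"
  shows "integrable M (\<lambda>\<omega>. Y \<omega> ^ j)"
proof (rule Bochner_Integration.integrable_bound)
  interpret finite_measure M by fact
  show "integrable M (\<lambda>\<omega>. 1 + Y \<omega> ^ 4)" using int by simp
  have "\<bar>y\<bar> ^ j \<le> 1 + y ^ 4" for y :: real
  proof (cases "\<bar>y\<bar> \<le> 1")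
    case True
    then have "\<bar>y\<bar> ^ j \<le> 1" by (simp add: power_le_one)
    then show ?thesis by (simp add: add_increasing2)
  next
    case False
    then have "\<bar>y\<bar> ^ j \<le> \<bar>y\<bar> ^ 4" using \<open>j \<le> 4\<close> by (intro power_increasing) auto
    then show ?thesis by (simp add: power_even_abs)
  qed
  then show "AE \<omega> in M. norm (Y \<omega> ^ j) \<le> norm (1 + Y \<omega> ^ 4)"
    by (simp add: power_abs abs_of_nonneg)
qed (use Y in measurable)

lemma (in prob_space) indep_var_expectation_powers:
  fixes X Y :: "'a \<Rightarrow> real"
  assumes ind: "indep_var borel X borel Y"
    and X: "integrable M (\<lambda>\<omega>. X \<omega> ^ i)" and Y: "integrable M (\<lambda>\<omega>. Y \<omega> ^ j)"
  shows "integrable M (\<lambda>\<omega>. X \<omega> ^ i * Y \<omega> ^ j)"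
    and "expectation (\<lambda>\<omega>. X \<omega> ^ i * Y \<omega> ^ j) = expectation (\<lambda>\<omega>. X \<omega> ^ i) * expectation (\<lambda>\<omega>. Y \<omega> ^ j)"
proof -
  have "indep_var borel ((\<lambda>x. x ^ i) \<circ> X) borel ((\<lambda>y. y ^ j) \<circ> Y)"
    by (intro indep_var_compose[OF ind]) measurable
  then have *: "indep_var borel (\<lambda>\<omega>. X \<omega> ^ i) borel (\<lambda>\<omega>. Y \<omega> ^ j)" by (simp add: comp_def)
  show "integrable M (\<lambda>\<omega>. X \<omega> ^ i * Y \<omega> ^ j)" using indep_var_integrable[OF * X Y] .
  show "expectation (\<lambda>\<omega>. X \<omega> ^ i * Y \<omega> ^ j) = expectation (\<lambda>\<omega>. X \<omega> ^ i) * expectation (\<lambda>\<omega>. Y \<omega> ^ j)"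
    using indep_var_lebesgue_integral[OF * X Y] .
qed

text \<open>The bounds are proved together by induction. With \<open>Y\<close> the new summand and
  \<open>S\<close> the old sum, independence and centring leave
  \<open>E Y^4 + 6 E Y^2 E S^2 + E S^4\<close> of the fourth moment, and
  \<open>K^2 + 6 n K^2 + 3 n^2 K^2 \<le> 3 (n + 1)^2 K^2\<close>.\<close>

lemma (in prob_space) fourth_moment_sum_indep:
  fixes X :: "nat \<Rightarrow> 'a \<Rightarrow> real"
  assumes ind: "indep_vars (\<lambda>_. borel) X {1..}"
    and int: "\<And>i. i \<ge> 1 \<Longrightarrow> integrable M (\<lambda>\<omega>. X i \<omega> ^ 4)"
    and mean: "\<And>i. i \<ge> 1 \<Longrightarrow> expectation (X i) = 0"
    and K: "\<And>i. i \<ge> 1 \<Longrightarrow> expectation (\<lambda>\<omega>. X i \<omega> ^ 2) \<le> K"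
      "\<And>i. i \<ge> 1 \<Longrightarrow> expectation (\<lambda>\<omega>. X i \<omega> ^ 4) \<le> K\<^sup>2"
  defines "S \<equiv> \<lambda>n \<omega>. \<Sum>i=1..n. X i \<omega>"
  shows "integrable M (\<lambda>\<omega>. S n \<omega> ^ 4) \<and> expectation (S n) = 0 \<and>
    expectation (\<lambda>\<omega>. S n \<omega> ^ 2) \<le> real n * K \<and> expectation (\<lambda>\<omega>. S n \<omega> ^ 4) \<le> 3 * (real n)\<^sup>2 * K\<^sup>2"
proof (induction n)
  case 0
  then show ?case by (simp add: S_def)
next
  case (Suc n)
  let ?Y = "X (Suc n)"
  have meas: "random_variable borel (X i)" if "i \<ge> 1" for i
    using ind that by (auto simp: indep_vars_def)
  have measS: "random_variable borel (S n)" unfolding S_def using meas by auto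
  have intY: "integrable M (\<lambda>\<omega>. ?Y \<omega> ^ j)" if "j \<le> 4" for j
    by (rule integrable_power_le_4[OF finite_measure_axioms meas int that]) simp_all
  have intS: "integrable M (\<lambda>\<omega>. S n \<omega> ^ j)" if "j \<le> 4" for j
    using integrable_power_le_4[OF finite_measure_axioms measS _ that] Suc by blast
  have "indep_vars (\<lambda>_. borel) X (insert (Suc n) {1..n})"
    using ind by (rule indep_vars_subset) auto
  then have indS: "indep_var borel ?Y borel (S n)"
    unfolding S_def by (intro indep_vars_sum) auto
  let ?s = "\<lambda>j. expectation (\<lambda>\<omega>. S n \<omega> ^ j)" and ?y = "\<lambda>j. expectation (\<lambda>\<omega>. ?Y \<omega> ^ j)"
  have Ssuc: "S (Suc n) \<omega> = ?Y \<omega> + S n \<omega>" for \<omega> by (simp add: S_def)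
  have 0: "?s 1 = 0" "?y 1 = 0" using Suc mean[of "Suc n"] by auto
  \<comment> \<open>Exponents 0 and 1 are kept explicit so that \<open>prod\<close> applies to every
    term of the expansion in the same way.\<close>
  have e4: "S (Suc n) \<omega> ^ 4 = ?Y \<omega> ^ 4 * S n \<omega> ^ 0 + 4 * (?Y \<omega> ^ 3 * S n \<omega> ^ 1)
      + 6 * (?Y \<omega> ^ 2 * S n \<omega> ^ 2) + 4 * (?Y \<omega> ^ 1 * S n \<omega> ^ 3) + ?Y \<omega> ^ 0 * S n \<omega> ^ 4" for \<omega>
    unfolding Ssuc by (simp add: power4_eq_xxxx power3_eq_cube power2_eq_square algebra_simps)
  have e2: "S (Suc n) \<omega> ^ 2 = ?Y \<omega> ^ 2 * S n \<omega> ^ 0 + 2 * (?Y \<omega> ^ 1 * S n \<omega> ^ 1)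
      + ?Y \<omega> ^ 0 * S n \<omega> ^ 2" for \<omega>
    unfolding Ssuc by (simp add: power2_eq_square algebra_simps)
  have e1: "S (Suc n) \<omega> = ?Y \<omega> ^ 1 + S n \<omega> ^ 1" for \<omega>
    unfolding Ssuc by simp
  have prod: "has_bochner_integral M (\<lambda>\<omega>. ?Y \<omega> ^ i * S n \<omega> ^ j) (?y i * ?s j)"
    if "i \<le> 4" "j \<le> 4" for i j
    using indep_var_expectation_powers[OF indS intY[OF that(1)] intS[OF that(2)]]
    by (simp add: has_bochner_integral_iff)
  have E4: "has_bochner_integral M (\<lambda>\<omega>. S (Suc n) \<omega> ^ 4) (?y 4 * ?s 0 + 4 * (?y 3 * ?s 1)
      + 6 * (?y 2 * ?s 2) + 4 * (?y 1 * ?s 3) + ?y 0 * ?s 4)"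
    unfolding e4 by (intro has_bochner_integral_add has_bochner_integral_mult_right prod) auto
  have E2: "has_bochner_integral M (\<lambda>\<omega>. S (Suc n) \<omega> ^ 2) (?y 2 * ?s 0 + 2 * (?y 1 * ?s 1) + ?y 0 * ?s 2)"
    unfolding e2 by (intro has_bochner_integral_add has_bochner_integral_mult_right prod) auto
  have E1: "expectation (S (Suc n)) = ?y 1 + ?s 1"
    using intY[of 1] intS[of 1] unfolding e1[abs_def] by (intro Bochner_Integration.integral_add) auto
  \<comment> \<open>Monotonicity of the product uses \<open>K \<ge> 0\<close>, which follows because
    \<open>K\<close> bounds the expectation of a square.\<close>
  have "?y 2 * ?s 2 \<le> K * (real n * K)"
    using Suc K(1)[of "Suc n"] order_trans[OF _ K(1)[of "Suc n"]] by (intro mult_mono) auto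
  then have "expectation (\<lambda>\<omega>. S (Suc n) \<omega> ^ 4) \<le> K\<^sup>2 + 6 * (K * (real n * K)) + 3 * (real n)\<^sup>2 * K\<^sup>2"
    unfolding has_bochner_integral_integral_eq[OF E4] 0 using Suc K(2)[of "Suc n"] by (simp add: prob_space)
  also have "\<dots> \<le> 3 * (real (Suc n))\<^sup>2 * K\<^sup>2"
    by (simp add: power2_eq_square algebra_simps)
  finally show ?case
    using E1 E2 E4 0 Suc K(1)[of "Suc n"] by (simp add: prob_space has_bochner_integral_iff algebra_simps)
qed

text \<open>The fourth powers \<open>F n\<close> of the averages have expectations of order
  \<open>1 / n^2\<close>, which is summable. By monotone convergence the series of the
  \<open>F n\<close> is almost surely finite, so its terms tend to 0.\<close>

theorem (in prob_space) strong_law_fourth_moment_centred: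
  fixes X :: "nat \<Rightarrow> 'a \<Rightarrow> real"
  assumes ind: "indep_vars (\<lambda>_. borel) X {1..}"
    and int: "\<And>i. i \<ge> 1 \<Longrightarrow> integrable M (\<lambda>\<omega>. X i \<omega> ^ 4)"
    and mean: "\<And>i. i \<ge> 1 \<Longrightarrow> expectation (X i) = 0"
    and K: "\<And>i. i \<ge> 1 \<Longrightarrow> expectation (\<lambda>\<omega>. X i \<omega> ^ 2) \<le> K"
      "\<And>i. i \<ge> 1 \<Longrightarrow> expectation (\<lambda>\<omega>. X i \<omega> ^ 4) \<le> K\<^sup>2"
  shows "AE \<omega> in M. (\<lambda>n. (1 / real n) * (\<Sum>i=1..n. X i \<omega>)) \<longlonglongrightarrow> 0"
proof -
  define F where "F n \<omega> = ((1 / real n) * (\<Sum>i=1..n. X i \<omega>)) ^ 4" for n \<omega>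
  note S = fourth_moment_sum_indep[OF assms]
  have intF: "integrable M (F n)" for n
    unfolding F_def power_mult_distrib using S by simp
  have EF: "expectation (F n) \<le> 3 * K\<^sup>2 * (1 / (real n)\<^sup>2)" for n
  \<comment> \<open>For \<open>n = 0\<close> both sides are 0, as division by 0 yields 0.\<close>
  proof (cases "n = 0")
    case False
    have "expectation (F n) = (1 / real n) ^ 4 * expectation (\<lambda>\<omega>. (\<Sum>i=1..n. X i \<omega>) ^ 4)"
      unfolding F_def power_mult_distrib by simp
    also have "\<dots> \<le> (1 / real n) ^ 4 * (3 * (real n)\<^sup>2 * K\<^sup>2)"
      using S[of n] by (intro mult_left_mono) auto
    also have "\<dots> = 3 * K\<^sup>2 * (1 / (real n)\<^sup>2)"
      using False by (simp add: power4_eq_xxxx power2_eq_square field_simps)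
    finally show ?thesis .
  qed (simp add: F_def[abs_def])
  have F0: "F n \<omega> \<ge> 0" for n \<omega> by (simp add: F_def)
  have "(\<integral>\<^sup>+\<omega>. (\<Sum>n. ennreal (F n \<omega>)) \<partial>M) = (\<Sum>n. \<integral>\<^sup>+\<omega>. ennreal (F n \<omega>) \<partial>M)"
    using intF by (intro nn_integral_suminf) auto
  also have "\<dots> = (\<Sum>n. ennreal (expectation (F n)))"
    using intF F0 by (simp add: nn_integral_eq_integral)
  also have "\<dots> \<le> (\<Sum>n. ennreal (3 * K\<^sup>2 * (1 / (real n)\<^sup>2)))"
    by (intro suminf_le ennreal_leI EF) auto
  also have "\<dots> < top"
  proof -
    have "summable (\<lambda>n. 3 * K\<^sup>2 * (1 / (real n)\<^sup>2))"
      using inverse_power_summable[of 2, where 'a=real] by (intro summable_mult) (simp add: inverse_eq_divide)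
    then show ?thesis by (subst suminf_ennreal2) auto
  qed
  finally have "AE \<omega> in M. (\<Sum>n. ennreal (F n \<omega>)) \<noteq> \<infinity>"
    using intF by (intro nn_integral_PInf_AE) auto
  then show ?thesis
  proof eventually_elim
    case (elim \<omega>)
    then have "summable (\<lambda>n. F n \<omega>)" using F0 by (intro summable_suminf_not_top) auto
    then have "(\<lambda>n. F n \<omega>) \<longlonglongrightarrow> 0" by (rule summable_LIMSEQ_zero)
    then show ?case unfolding F_def by (simp add: power_tendsto_0_iff)
  qed
qed

text \<open>The centred law is applied to \<open>g (X i)\<close> minus its mean; equal distributions
  turn all moments into integrals over \<open>N\<close> and so provide bounds uniform in
  \<open>i\<close>.\<close>

theorem (in prob_space) strong_law_identically_distributed:
  fixes X :: "nat \<Rightarrow> 'a \<Rightarrow> 'b::topological_space" and g :: "'b \<Rightarrow> real"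
  assumes ind: "indep_vars (\<lambda>_. borel) X {1..}"
    and distr: "\<And>i. i \<ge> 1 \<Longrightarrow> distr M borel (X i) = N"
    and g: "g \<in> borel_measurable borel" and int: "integrable N (\<lambda>x. g x ^ 4)"
  shows "AE \<omega> in M. (\<lambda>n. (1 / real n) * (\<Sum>i=1..n. g (X i \<omega>))) \<longlonglongrightarrow> integral\<^sup>L N g"
proof -
  have X: "random_variable borel (X i)" if "i \<ge> 1" for i
    using ind that by (auto simp: indep_vars_def)
  have N: "sets N = sets borel" "prob_space N"
    using distr[of 1] prob_space_distr[OF X[of 1]] by auto
  interpret N: prob_space N by fact
  let ?e = "integral\<^sup>L N g"
  have gN [measurable]: "g \<in> borel_measurable N" using g N(1) by (simp cong: measurable_cong_sets)
  have intg: "integrable N (\<lambda>x. g x ^ j)" if "j \<le> 4" for j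
    by (rule integrable_power_le_4[OF N.finite_measure_axioms gN int that])
  have int4: "integrable N (\<lambda>x. (g x - ?e) ^ 4)"
  proof -
    have "(g x - ?e) ^ 4 = g x ^ 4 - 4 * ?e * g x ^ 3 + 6 * ?e ^ 2 * g x ^ 2 - 4 * ?e ^ 3 * g x ^ 1 + ?e ^ 4" for x
      by (simp add: power4_eq_xxxx power3_eq_cube power2_eq_square algebra_simps)
    then show ?thesis using intg[of 1] intg[of 2] intg[of 3] int by simp
  qed
  \<comment> \<open>The lower bound 1 gives \<open>K \<le> K^2\<close>, so that one constant serves
    as \<open>K\<close> for second moments and as \<open>K^2\<close> for fourth moments.\<close>
  define K where "K = max (integral\<^sup>L N (\<lambda>x. (g x - ?e) ^ 2)) (max 1 (integral\<^sup>L N (\<lambda>x. (g x - ?e) ^ 4)))"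
  have K1: "K \<ge> 1" by (simp add: K_def)
  have tr: "integrable M (\<lambda>\<omega>. h (X i \<omega>)) \<longleftrightarrow> integrable N h" "expectation (\<lambda>\<omega>. h (X i \<omega>)) = integral\<^sup>L N h"
    if "i \<ge> 1" "h \<in> borel_measurable borel" for h :: "'b \<Rightarrow> real" and i
    using X[OF that(1)] that(2) distr[OF that(1), symmetric]
    by (simp_all add: integrable_distr_eq integral_distr)
  have "AE \<omega> in M. (\<lambda>n. (1 / real n) * (\<Sum>i=1..n. g (X i \<omega>) - ?e)) \<longlonglongrightarrow> 0"
  proof (rule strong_law_fourth_moment_centred)
    show "indep_vars (\<lambda>_. borel) (\<lambda>i \<omega>. g (X i \<omega>) - ?e) {1..}"
      by (intro indep_vars_compose2[OF ind] borel_measurable_diff g borel_measurable_const)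
    fix i :: nat assume i: "i \<ge> 1"
    show "integrable M (\<lambda>\<omega>. (g (X i \<omega>) - ?e) ^ 4)"
      using tr(1)[OF i, of "\<lambda>x. (g x - ?e) ^ 4"] g int4 by simp
    show "expectation (\<lambda>\<omega>. g (X i \<omega>) - ?e) = 0"
      using tr(2)[OF i, of "\<lambda>x. g x - ?e"] g intg[of 1] by (simp add: N.prob_space)
    show "expectation (\<lambda>\<omega>. (g (X i \<omega>) - ?e) ^ 2) \<le> K"
      using tr(2)[OF i, of "\<lambda>x. (g x - ?e) ^ 2"] g by (simp add: K_def)
    have "expectation (\<lambda>\<omega>. (g (X i \<omega>) - ?e) ^ 4) \<le> K"
      using tr(2)[OF i, of "\<lambda>x. (g x - ?e) ^ 4"] g by (simp add: K_def)
    also have "K \<le> K\<^sup>2" using K1 by (simp add: power2_eq_square)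
    finally show "expectation (\<lambda>\<omega>. (g (X i \<omega>) - ?e) ^ 4) \<le> K\<^sup>2" .
  qed
  then show ?thesis
  proof eventually_elim
    case (elim \<omega>)
    \<comment> \<open>The two expressions agree once \<open>n > 0\<close>; at 0 the average of the
      constants would be 0 instead of the mean.\<close>
    have "eventually (\<lambda>n. (1 / real n) * (\<Sum>i=1..n. g (X i \<omega>) - ?e) + ?e
        = (1 / real n) * (\<Sum>i=1..n. g (X i \<omega>))) sequentially"
      using eventually_gt_at_top[of 0] by eventually_elim (simp add: sum_subtractf field_simps)
    moreover have "(\<lambda>n. (1 / real n) * (\<Sum>i=1..n. g (X i \<omega>) - ?e) + ?e) \<longlonglongrightarrow> 0 + ?e"
      by (intro tendsto_intros elim)
    ultimately show ?case by (simp add: tendsto_cong)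
  qed
qed

section \<open>Moments of normal mixtures\<close>

text \<open>The defining identity for sets extends to nonnegative functions by induction over
  indicators, multiples, sums and monotone limits.\<close>

lemma nn_integral_mixture:
  assumes sets: "sets Q = sets P" and f: "f \<in> borel_measurable P"
  shows "(\<integral>\<^sup>+x. f x \<partial>mixture a P b Q) = ennreal a * (\<integral>\<^sup>+x. f x \<partial>P) + ennreal b * (\<integral>\<^sup>+x. f x \<partial>Q)"
  using f
proof (induction rule: borel_measurable_induct)
  case (cong f g)
  have "space Q = space P" using sets by (rule sets_eq_imp_space_eq)
  then show ?case
    using cong nn_integral_cong[of P f g] nn_integral_cong[of Q f g]
      nn_integral_cong[of "mixture a P b Q" f g] by simp
next
  case (set A)
  then show ?case using sets by (simp add: emeasure_mixture)
next
  case (mult f c)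
  have "f \<in> borel_measurable (mixture a P b Q)" "f \<in> borel_measurable Q"
    using mult sets by (simp_all cong: measurable_cong_sets)
  then show ?case
    using mult by (simp add: nn_integral_cmult distrib_left mult.left_commute)
next
  case (add f g)
  have "f \<in> borel_measurable (mixture a P b Q)" "f \<in> borel_measurable Q"
    "g \<in> borel_measurable (mixture a P b Q)" "g \<in> borel_measurable Q"
    using add sets by (simp_all cong: measurable_cong_sets)
  then show ?case
    using add by (simp add: nn_integral_add distrib_left ac_simps)
next
  case (seq U)
  have m: "U i \<in> borel_measurable (mixture a P b Q)" "U i \<in> borel_measurable Q" for i
    using seq sets by (simp_all cong: measurable_cong_sets)
  have inc: "incseq (\<lambda>i. ennreal c * integral\<^sup>N R (U i))" for c and R :: "'a measure"
    using \<open>incseq U\<close> by (auto simp: incseq_def le_fun_def intro!: mult_left_mono nn_integral_mono)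
  have "(\<integral>\<^sup>+x. (SUP i. U i) x \<partial>R) = (SUP i. integral\<^sup>N R (U i))"
    if "\<And>i. U i \<in> borel_measurable R" for R
    unfolding SUP_apply by (intro nn_integral_monotone_convergence_SUP seq that)
  then show ?case
    using seq m by (simp add: SUP_mult_left_ennreal ennreal_SUP_add[OF inc inc])
qed

lemma has_bochner_integral_mixture_nonneg:
  fixes f :: "'a \<Rightarrow> real"
  assumes sets: "sets Q = sets P" and ab: "a \<ge> 0" "b \<ge> 0" and f: "\<And>x. f x \<ge> 0"
    and P: "has_bochner_integral P f x" and Q: "has_bochner_integral Q f y"
  shows "has_bochner_integral (mixture a P b Q) f (a * x + b * y)"
proof -
  have xy: "x \<ge> 0" "y \<ge> 0"
    using P Q f by (auto simp: has_bochner_integral_iff intro: Bochner_Integration.integral_nonneg)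
  have m: "f \<in> borel_measurable P" using P by (simp add: has_bochner_integral_iff borel_measurable_integrable)
  have nP: "(\<integral>\<^sup>+x. f x \<partial>P) = ennreal x" "(\<integral>\<^sup>+x. f x \<partial>Q) = ennreal y"
    using P Q f by (auto simp: has_bochner_integral_iff nn_integral_eq_integral)
  show ?thesis
  proof (rule has_bochner_integral_nn_integral)
    show "f \<in> borel_measurable (mixture a P b Q)" using m by (simp cong: measurable_cong_sets)
    show "(\<integral>\<^sup>+x. f x \<partial>mixture a P b Q) = ennreal (a * x + b * y)"
      using m xy ab by (simp add: nn_integral_mixture[OF sets] nP ennreal_mult)
  qed (use f xy ab in auto)
qed

text \<open>Splitting \<open>f\<close> into positive and negative parts reduces the claim to the
  nonnegative case.\<close>

lemma has_bochner_integral_mixture: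
  fixes f :: "'a \<Rightarrow> real"
  assumes sets: "sets Q = sets P" and ab: "a \<ge> 0" "b \<ge> 0"
    and P: "has_bochner_integral P f x" and Q: "has_bochner_integral Q f y"
  shows "has_bochner_integral (mixture a P b Q) f (a * x + b * y)"
proof -
  have decomp: "\<exists>c d. has_bochner_integral R (\<lambda>z. max (f z) 0) c \<and> has_bochner_integral R (\<lambda>z. max (- f z) 0) d \<and> r = c - d"
    if "has_bochner_integral R f r" for R r
  proof -
    have i: "integrable R f" and r: "integral\<^sup>L R f = r"
      using that by (auto simp: has_bochner_integral_iff)
    have "integrable R (\<lambda>z. max (f z) 0)" "integrable R (\<lambda>z. max (- f z) 0)" using i by auto
    moreover have "r = integral\<^sup>L R (\<lambda>z. max (f z) 0 - max (- f z) 0)"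
      unfolding r[symmetric] by (intro Bochner_Integration.integral_cong) auto
    ultimately show ?thesis by (auto simp: has_bochner_integral_iff)
  qed
  obtain c d where x: "has_bochner_integral P (\<lambda>z. max (f z) 0) c" "has_bochner_integral P (\<lambda>z. max (- f z) 0) d" "x = c - d"
    using decomp[OF P] by blast
  obtain c' d' where y: "has_bochner_integral Q (\<lambda>z. max (f z) 0) c'" "has_bochner_integral Q (\<lambda>z. max (- f z) 0) d'" "y = c' - d'"
    using decomp[OF Q] by blast
  have "has_bochner_integral (mixture a P b Q) (\<lambda>z. max (f z) 0 - max (- f z) 0) ((a * c + b * c') - (a * d + b * d'))"
    by (intro has_bochner_integral_diff has_bochner_integral_mixture_nonneg sets ab x y) auto
  moreover have "(\<lambda>z. max (f z) 0 - max (- f z) 0) = f" by (auto simp: fun_eq_iff)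
  ultimately show ?thesis by (simp add: x(3) y(3) algebra_simps)
qed

section \<open>Moments of projections of a matrix normal distribution\<close>

text \<open>Raw moments follow from the central ones by expanding the powers of
  \<open>x = (x - m) + m\<close>; odd central moments vanish.\<close>

lemma normal_density_moments:
  assumes "0 < \<sigma>"
  shows "has_bochner_integral lborel (\<lambda>x. normal_density m \<sigma> x * x ^ 2) (m\<^sup>2 + \<sigma>\<^sup>2)"
    and "has_bochner_integral lborel (\<lambda>x. normal_density m \<sigma> x * x ^ 3) (m ^ 3 + 3 * m * \<sigma>\<^sup>2)"
    and "has_bochner_integral lborel (\<lambda>x. normal_density m \<sigma> x * x ^ 4) (m ^ 4 + 6 * m\<^sup>2 * \<sigma>\<^sup>2 + 3 * \<sigma> ^ 4)"
    and "integrable lborel (\<lambda>x. normal_density m \<sigma> x * x ^ k)"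
proof -
  let ?N = "normal_density m \<sigma>"
  have 0: "has_bochner_integral lborel (\<lambda>x. ?N x * (x - m) ^ 0) 1"
    using normal_moment_even[OF assms, of m 0] by simp
  have 1: "has_bochner_integral lborel (\<lambda>x. ?N x * (x - m) ^ 1) 0"
    using normal_moment_odd[OF assms, of m 0] by simp
  have 2: "has_bochner_integral lborel (\<lambda>x. ?N x * (x - m) ^ 2) (\<sigma>\<^sup>2)"
    using normal_moment_even[OF assms, of m 1] assms by simp
  have 3: "has_bochner_integral lborel (\<lambda>x. ?N x * (x - m) ^ 3) 0"
    using normal_moment_odd[OF assms, of m 1] by (simp add: eval_nat_numeral)
  have 4: "has_bochner_integral lborel (\<lambda>x. ?N x * (x - m) ^ 4) (3 * \<sigma> ^ 4)"
    using normal_moment_even[OF assms, of m 2] assms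
    by (simp add: eval_nat_numeral field_simps)
  have "has_bochner_integral lborel (\<lambda>x. ?N x * (x - m) ^ 2 + (2 * m) * (?N x * (x - m) ^ 1)
      + m\<^sup>2 * (?N x * (x - m) ^ 0)) (\<sigma>\<^sup>2 + (2 * m) * 0 + m\<^sup>2 * 1)"
    by (intro has_bochner_integral_add has_bochner_integral_mult_right 0 1 2)
  then show "has_bochner_integral lborel (\<lambda>x. ?N x * x ^ 2) (m\<^sup>2 + \<sigma>\<^sup>2)"
    by (simp add: power2_eq_square algebra_simps)
  have "has_bochner_integral lborel (\<lambda>x. ?N x * (x - m) ^ 3 + (3 * m) * (?N x * (x - m) ^ 2)
      + (3 * m\<^sup>2) * (?N x * (x - m) ^ 1) + m ^ 3 * (?N x * (x - m) ^ 0)) (0 + (3 * m) * \<sigma>\<^sup>2 + (3 * m\<^sup>2) * 0 + m ^ 3 * 1)"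
    by (intro has_bochner_integral_add has_bochner_integral_mult_right 0 1 2 3)
  then show "has_bochner_integral lborel (\<lambda>x. ?N x * x ^ 3) (m ^ 3 + 3 * m * \<sigma>\<^sup>2)"
    by (simp add: power2_eq_square power3_eq_cube algebra_simps)
  have "has_bochner_integral lborel (\<lambda>x. ?N x * (x - m) ^ 4 + (4 * m) * (?N x * (x - m) ^ 3)
      + (6 * m\<^sup>2) * (?N x * (x - m) ^ 2) + (4 * m ^ 3) * (?N x * (x - m) ^ 1) + m ^ 4 * (?N x * (x - m) ^ 0))
      (3 * \<sigma> ^ 4 + (4 * m) * 0 + (6 * m\<^sup>2) * \<sigma>\<^sup>2 + (4 * m ^ 3) * 0 + m ^ 4 * 1)"
    by (intro has_bochner_integral_add has_bochner_integral_mult_right 0 1 2 3 4)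
  then show "has_bochner_integral lborel (\<lambda>x. ?N x * x ^ 4) (m ^ 4 + 6 * m\<^sup>2 * \<sigma>\<^sup>2 + 3 * \<sigma> ^ 4)"
    by (simp add: power2_eq_square power3_eq_cube power4_eq_xxxx algebra_simps)
  have "?N x * x ^ k = (\<Sum>j\<le>k. (of_nat (k choose j) * m ^ (k - j)) * (?N x * (x - m) ^ j))" for x
    using binomial_ring[of "x - m" m k] by (simp add: sum_distrib_left ac_simps)
  then show "integrable lborel (\<lambda>x. ?N x * x ^ k)"
    using integrable_normal_moment[OF assms] by simp
qed

lemma sets_std_normal [simp, measurable_cong]: "sets std_normal = sets borel"
  by (simp add: std_normal_def)

lemma
  shows indep_vars_std_normal_product:
      "prob_space.indep_vars (\<Pi>\<^sub>M (i :: 'i::finite) \<in> UNIV. std_normal) (\<lambda>_. borel) (\<lambda>i z. z i) UNIV"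
    and distributed_std_normal_product:
      "distributed (\<Pi>\<^sub>M (i :: 'i::finite) \<in> UNIV. std_normal) lborel (\<lambda>z. z i) (normal_density 0 1)"
proof -
  let ?P = "\<Pi>\<^sub>M (i :: 'i) \<in> UNIV. std_normal"
  interpret P: prob_space ?P by (intro prob_space_PiM prob_space_std_normal)
  have distr: "distr ?P std_normal (\<lambda>z. z i) = std_normal" for i
    by (rule distr_PiM_component) (auto intro: prob_space_std_normal)
  have meas: "(\<lambda>z. z i) \<in> ?P \<rightarrow>\<^sub>M borel" for i
    using measurable_component_singleton[of i UNIV "\<lambda>_. std_normal"] by (simp cong: measurable_cong_sets)
  have distr': "distr ?P borel (\<lambda>z. z i) = std_normal" for i
    using distr[of i] by (metis distr_cong sets_std_normal)
  show "P.indep_vars (\<lambda>_. borel) (\<lambda>i z. z i) UNIV"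
  proof (subst P.indep_vars_iff_distr_eq_PiM)
    \<comment> \<open>Independence is checked through the joint law: the family of all coordinates
      is the identity map, so its law is the product measure itself.\<close>
    have "distr ?P (\<Pi>\<^sub>M i\<in>UNIV. borel) (\<lambda>x. \<lambda>i\<in>UNIV. x i) = distr ?P ?P (\<lambda>x. x)"
      by (intro distr_cong) (auto intro!: sets_PiM_cong)
    also have "\<dots> = ?P" by (rule distr_id)
    finally show "distr ?P (\<Pi>\<^sub>M i\<in>UNIV. borel) (\<lambda>x. \<lambda>i\<in>UNIV. x i) = (\<Pi>\<^sub>M i\<in>UNIV. distr ?P borel (\<lambda>z. z i))"
      by (simp add: distr')
  qed (use meas in auto)
  have "distr ?P lborel (\<lambda>z. z i) = std_normal"
    using distr'[of i] by (metis distr_cong sets_lborel)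
  then show "distributed ?P lborel (\<lambda>z. z i) (normal_density 0 1)"
    using meas[of i] by (simp add: distributed_def std_normal_def)
qed

text \<open>A sum of independent normals is normal when all standard deviations are positive. Zero
  coefficients are therefore dropped first; \<open>c j \<noteq> 0\<close> keeps the remaining index
  set nonempty.\<close>

lemma distributed_std_normal_linear_form:
  fixes c :: "'i::finite \<Rightarrow> real"
  assumes "c j \<noteq> 0"
  shows "distributed (\<Pi>\<^sub>M i \<in> UNIV. std_normal) lborel (\<lambda>z. \<Sum>i\<in>UNIV. c i * z i)
           (normal_density 0 (sqrt (\<Sum>i\<in>UNIV. (c i)\<^sup>2)))"
proof -
  let ?P = "\<Pi>\<^sub>M (i :: 'i) \<in> UNIV. std_normal" and ?I = "{i. c i \<noteq> 0}"
  interpret P: prob_space ?P by (intro prob_space_PiM prob_space_std_normal)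
  have "P.indep_vars (\<lambda>_. borel) (\<lambda>i z. c i * z i) UNIV"
    by (rule P.indep_vars_compose2[OF indep_vars_std_normal_product]) auto
  then have ind: "P.indep_vars (\<lambda>_. borel) (\<lambda>i z. c i * z i) ?I"
    by (rule P.indep_vars_subset) auto
  have "distributed ?P lborel (\<lambda>z. c i * z i) (normal_density 0 \<bar>c i\<bar>)" if "i \<in> ?I" for i
    using P.normal_density_affine[OF distributed_std_normal_product[of i], of "c i" 0] that by simp
  then have "distributed ?P lborel (\<lambda>z. \<Sum>i\<in>?I. c i * z i)
      (normal_density (\<Sum>i\<in>?I. 0) (sqrt (\<Sum>i\<in>?I. \<bar>c i\<bar>\<^sup>2)))"
    using assms by (intro P.sum_indep_normal ind) auto
  moreover have "(\<Sum>i\<in>?I. c i * z i) = (\<Sum>i\<in>UNIV. c i * z i)" for z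
    by (rule sum.mono_neutral_left) auto
  moreover have "(\<Sum>i\<in>?I. \<bar>c i\<bar>\<^sup>2) = (\<Sum>i\<in>UNIV. (c i)\<^sup>2)"
    by (simp, rule sum.mono_neutral_left) auto
  ultimately show ?thesis by simp
qed

lemma inner_mult_outer: "u \<bullet> (Y *v v) = (\<Sum>ij\<in>UNIV. (u $ fst ij * v $ snd ij) * Y $ fst ij $ snd ij)"
  for Y :: "real^'q^'p"
proof -
  have "u \<bullet> (Y *v v) = (\<Sum>i\<in>UNIV. \<Sum>j\<in>UNIV. u $ i * v $ j * Y $ i $ j)"
    by (simp add: inner_vec_def matrix_vector_mult_def sum_distrib_left ac_simps)
  then show ?thesis
    by (simp add: sum.cartesian_product case_prod_beta)
qed

lemma borel_measurable_bilinear_form [measurable]: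
  "(\<lambda>Y :: real^'q^'p. u \<bullet> ((Y - m) *v v)) \<in> borel_measurable borel"
  unfolding inner_mult_outer by (intro borel_measurable_continuous_onI continuous_intros)

text \<open>With \<open>u' = S *v u\<close> and \<open>v' = R *v v\<close>, the noise term is a
  linear form in the independent entries of \<open>Z\<close> whose coefficients are the products of
  entries of \<open>u'\<close> and \<open>v'\<close>. Their squares sum to the product of the
  squared norms of \<open>u'\<close> and \<open>v'\<close>, which gives the variance.\<close>

lemma distributed_matrix_normal_bilinear_form:
  fixes A :: "real^'p^'p" and B :: "real^'q^'q"
  assumes A: "sym_pos_def A" and B: "sym_pos_def B" and uv: "u \<noteq> 0" "v \<noteq> 0"
  shows "distributed (matrix_normal T A B) lborel (\<lambda>Y. u \<bullet> ((Y - m) *v v))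
    (normal_density (u \<bullet> ((T - m) *v v)) (sqrt ((u \<bullet> (A *v u)) * (v \<bullet> (B *v v)))))"
proof -
  let ?P = "\<Pi>\<^sub>M (ij :: 'p \<times> 'q) \<in> UNIV. std_normal"
  interpret P: prob_space ?P by (intro prob_space_PiM prob_space_std_normal)
  define S R where "S = mat_sqrt A" and "R = mat_sqrt B"
  have S: "sym_pos_def S" "S ** S = A" and R: "sym_pos_def R" "R ** R = B"
    unfolding S_def R_def using mat_sqrt A B by auto
  have norm2: "(norm (L *v x))\<^sup>2 = x \<bullet> ((L ** L) *v x)" if "sym_pos_def L" for L :: "real^'a^'a" and x
    using that inner_matrix_transpose[of x L "L *v x"]
    by (simp add: power2_norm_eq_inner sym_pos_def_def flip: matrix_vector_mul_assoc)
  define u' v' where "u' = S *v u" and "v' = R *v v"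
  have u'2: "(norm u')\<^sup>2 = u \<bullet> (A *v u)" and v'2: "(norm v')\<^sup>2 = v \<bullet> (B *v v)"
    unfolding u'_def v'_def using norm2 S R by auto
  have "u' \<noteq> 0" "v' \<noteq> 0"
    using u'2 v'2 A B uv by (force simp: sym_pos_def_def)+
  \<comment> \<open>These indices give a nonzero coefficient, as the normal law of the linear form
    demands.\<close>
  then obtain i j where ij: "u' $ i \<noteq> 0" "v' $ j \<noteq> 0" by (auto simp: vec_eq_iff)
  have form: "u \<bullet> ((S ** Z ** R) *v v) = (\<Sum>ij\<in>UNIV. (u' $ fst ij * v' $ snd ij) * Z $ fst ij $ snd ij)" for Z
  proof -
    have "u \<bullet> ((S ** Z ** R) *v v) = u \<bullet> (S *v (Z *v v'))"
      by (simp add: v'_def flip: matrix_vector_mul_assoc)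
    also have "\<dots> = u' \<bullet> (Z *v v')"
      using S(1) by (metis inner_matrix_transpose sym_pos_def_def u'_def)
    finally show ?thesis by (simp add: inner_mult_outer)
  qed
  have "(\<Sum>ij\<in>UNIV. (u' $ fst ij * v' $ snd ij)\<^sup>2) = (norm u')\<^sup>2 * (norm v')\<^sup>2"
    unfolding UNIV_Times_UNIV[symmetric] power2_norm_eq_inner inner_vec_def
    by (simp add: sum_product sum.cartesian_product power_mult_distrib power2_eq_square ac_simps
        case_prod_beta del: UNIV_Times_UNIV)
  with distributed_std_normal_linear_form[of "\<lambda>ij. u' $ fst ij * v' $ snd ij" "(i, j)"] ij
  have D: "distributed ?P lborel (\<lambda>z. u \<bullet> ((S ** (\<chi> i j. z (i, j)) ** R) *v v))
      (normal_density 0 (sqrt ((u \<bullet> (A *v u)) * (v \<bullet> (B *v v)))))"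
    unfolding form u'2[symmetric] v'2[symmetric] by (simp add: case_prod_beta)
  have pos: "0 < sqrt ((u \<bullet> (A *v u)) * (v \<bullet> (B *v v)))"
    using A B uv by (simp add: sym_pos_def_def)
  have "distributed ?P lborel (\<lambda>z. u \<bullet> ((T - m) *v v) + 1 * (u \<bullet> ((S ** (\<chi> i j. z (i, j)) ** R) *v v)))
      (normal_density (u \<bullet> ((T - m) *v v) + 1 * 0) (\<bar>1\<bar> * sqrt ((u \<bullet> (A *v u)) * (v \<bullet> (B *v v)))))"
    by (rule P.normal_density_affine[OF D pos]) simp
  moreover have "u \<bullet> ((T - m) *v v) + 1 * (u \<bullet> (W *v v)) = u \<bullet> ((T + W - m) *v v)" for W
    by (simp add: matrix_vector_mult_diff_rdistrib matrix_vector_mult_add_rdistrib inner_add_right inner_diff_right)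
  ultimately have D': "distributed ?P lborel (\<lambda>z. u \<bullet> ((T + S ** (\<chi> i j. z (i, j)) ** R - m) *v v))
      (normal_density (u \<bullet> ((T - m) *v v)) (sqrt ((u \<bullet> (A *v u)) * (v \<bullet> (B *v v)))))"
    by simp
  have "distr (matrix_normal T A B) lborel (\<lambda>Y. u \<bullet> ((Y - m) *v v))
      = distr ?P lborel ((\<lambda>Y. u \<bullet> ((Y - m) *v v)) \<circ> (\<lambda>z. T + S ** (\<chi> i j. z (i, j)) ** R))"
    unfolding matrix_normal_def S_def R_def
    by (intro distr_distr measurable_matrix_normal_map) simp
  then show ?thesis using D'
    by (simp add: distributed_def comp_def matrix_normal_def)
qed

lemma distributed_has_bochner_integral:
  assumes "distributed M lborel X f" and "\<And>x. 0 \<le> f x" and g: "g \<in> borel_measurable borel"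
    and "has_bochner_integral lborel (\<lambda>x. f x * g x :: real) c"
  shows "has_bochner_integral M (\<lambda>\<omega>. g (X \<omega>)) c"
  using assms distributed_integral[OF assms(1), of g] distributed_integrable[OF assms(1), of g]
  by (auto simp: has_bochner_integral_iff)

lemma
  fixes A :: "real^'p^'p" and B :: "real^'q^'q"
  assumes A: "sym_pos_def A" and B: "sym_pos_def B" and uv: "u \<noteq> 0" "v \<noteq> 0"
  defines "\<tau> \<equiv> (u \<bullet> (A *v u)) * (v \<bullet> (B *v v))"
  shows matrix_normal_bilinear_moment_1: "has_bochner_integral (matrix_normal T A B) (\<lambda>Y. u \<bullet> ((Y - m) *v v))
      (u \<bullet> ((T - m) *v v))"
    and matrix_normal_bilinear_moment_2: "has_bochner_integral (matrix_normal T A B) (\<lambda>Y. (u \<bullet> ((Y - m) *v v)) ^ 2)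
      ((u \<bullet> ((T - m) *v v))\<^sup>2 + \<tau>)"
    and matrix_normal_bilinear_moment_3: "has_bochner_integral (matrix_normal T A B) (\<lambda>Y. (u \<bullet> ((Y - m) *v v)) ^ 3)
      ((u \<bullet> ((T - m) *v v)) ^ 3 + 3 * (u \<bullet> ((T - m) *v v)) * \<tau>)"
    and matrix_normal_bilinear_moment_4: "has_bochner_integral (matrix_normal T A B) (\<lambda>Y. (u \<bullet> ((Y - m) *v v)) ^ 4)
      ((u \<bullet> ((T - m) *v v)) ^ 4 + 6 * (u \<bullet> ((T - m) *v v))\<^sup>2 * \<tau> + 3 * \<tau>\<^sup>2)"
    and matrix_normal_bilinear_integrable: "integrable (matrix_normal T A B) (\<lambda>Y. (u \<bullet> ((Y - m) *v v)) ^ k)"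
proof -
  have pos: "\<tau> > 0" using A B uv by (simp add: \<tau>_def sym_pos_def_def)
  then have s: "0 < sqrt \<tau>" "(sqrt \<tau>)\<^sup>2 = \<tau>" "(sqrt \<tau>) ^ 4 = \<tau>\<^sup>2"
    using power_mult[of "sqrt \<tau>" 2 2] by auto
  note D = distributed_matrix_normal_bilinear_form[OF A B uv, of T m, folded \<tau>_def]
  note tr = distributed_has_bochner_integral[OF D normal_density_nonneg]
  note mom = normal_density_moments[OF s(1), of "u \<bullet> ((T - m) *v v)", unfolded s]
  show "has_bochner_integral (matrix_normal T A B) (\<lambda>Y. u \<bullet> ((Y - m) *v v)) (u \<bullet> ((T - m) *v v))"
    using tr[OF _ normal_moment_nz_1[OF s(1)]] by simp
  show "has_bochner_integral (matrix_normal T A B) (\<lambda>Y. (u \<bullet> ((Y - m) *v v)) ^ 2)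
      ((u \<bullet> ((T - m) *v v))\<^sup>2 + \<tau>)" using tr[OF _ mom(1)] by simp
  show "has_bochner_integral (matrix_normal T A B) (\<lambda>Y. (u \<bullet> ((Y - m) *v v)) ^ 3)
      ((u \<bullet> ((T - m) *v v)) ^ 3 + 3 * (u \<bullet> ((T - m) *v v)) * \<tau>)" using tr[OF _ mom(2)] by simp
  show "has_bochner_integral (matrix_normal T A B) (\<lambda>Y. (u \<bullet> ((Y - m) *v v)) ^ 4)
      ((u \<bullet> ((T - m) *v v)) ^ 4 + 6 * (u \<bullet> ((T - m) *v v))\<^sup>2 * \<tau> + 3 * \<tau>\<^sup>2)"
    using tr[OF _ mom(3)] by simp
  show "integrable (matrix_normal T A B) (\<lambda>Y. (u \<bullet> ((Y - m) *v v)) ^ k)"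
    using tr[OF _ has_bochner_integral_integrable[OF mom(4)], of k] by (simp add: has_bochner_integral_iff)
qed

lemma sets_matrix_normal [simp, measurable_cong]: "sets (matrix_normal T A B) = sets borel"
  by (simp add: matrix_normal_def)

section \<open>Moments of the normal mixture\<close>

lemma integrable_mixture:
  fixes f :: "'a \<Rightarrow> real"
  assumes "sets Q = sets P" "a \<ge> 0" "b \<ge> 0" "integrable P f" "integrable Q f"
  shows "integrable (mixture a P b Q) f"
  using has_bochner_integral_mixture[OF assms(1-3) has_bochner_integral_integrable[OF assms(4)]
      has_bochner_integral_integrable[OF assms(5)]]
  by (simp add: has_bochner_integral_iff)

text \<open>Induction over the factors with the bound
  \<open>\<bar>a * b\<bar> \<le> a^2 + b^2\<close>. The bound doubles the exponent, which is why
  integrability is assumed and proved for all powers.\<close>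

lemma integrable_prod_power:
  fixes g :: "'i \<Rightarrow> 'a \<Rightarrow> real"
  assumes "finite K" and "\<And>l. l \<in> K \<Longrightarrow> g l \<in> borel_measurable M"
    and int: "\<And>l j. l \<in> K \<Longrightarrow> integrable M (\<lambda>x. g l x ^ j)"
    and "finite_measure M"
  shows "integrable M (\<lambda>x. (\<Prod>l\<in>K. g l x) ^ j)"
  using assms(1-3)
proof (induction K arbitrary: j rule: finite_induct)
  case empty
  interpret finite_measure M by fact
  show ?case by simp
next
  case (insert l K)
  let ?p = "\<lambda>x. \<Prod>l\<in>K. g l x"
  have "integrable M (\<lambda>x. g l x ^ j * ?p x ^ j)"
  proof (rule Bochner_Integration.integrable_bound)
    show "integrable M (\<lambda>x. g l x ^ (2 * j) + ?p x ^ (2 * j))"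
      using insert by (intro Bochner_Integration.integrable_add) auto
    show "(\<lambda>x. g l x ^ j * ?p x ^ j) \<in> borel_measurable M"
      using insert.prems(1) by (intro borel_measurable_times borel_measurable_power borel_measurable_prod) auto
    have "\<bar>a * b\<bar> \<le> a\<^sup>2 + b\<^sup>2" for a b :: real
    proof -
      have "2 * \<bar>a * b\<bar> \<le> a\<^sup>2 + b\<^sup>2"
        using sum_squares_bound[of "\<bar>a\<bar>" "\<bar>b\<bar>"] by (simp add: abs_mult mult.assoc)
      then show ?thesis using abs_ge_zero[of "a * b"] by linarith
    qed
    then show "AE x in M. norm (g l x ^ j * ?p x ^ j) \<le> norm (g l x ^ (2 * j) + ?p x ^ (2 * j))"
      by (simp add: power_even_eq power_mult mult.commute[of 2])
  qed
  then show ?case using insert.hyps by (simp add: power_mult_distrib)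
qed

text \<open>After centring at the mixture mean, the components with weights \<open>a\<close> and
  \<open>b\<close> have means \<open>- b * \<delta>\<close> and \<open>a * \<delta>\<close>. The
  left sides mix the corresponding normal moments with variance \<open>\<tau>\<close>.\<close>

lemma two_component_moments:
  fixes a b \<delta> \<tau> :: real
  assumes "b = 1 - a"
  shows "a * ((- b * \<delta>)\<^sup>2 + \<tau>) + b * ((a * \<delta>)\<^sup>2 + \<tau>) = a * b * \<delta>\<^sup>2 + \<tau>"
    and "a * ((- b * \<delta>) ^ 3 + 3 * (- b * \<delta>) * \<tau>) + b * ((a * \<delta>) ^ 3 + 3 * (a * \<delta>) * \<tau>)
      = a * b * (a - b) * \<delta> ^ 3"
    and "a * ((- b * \<delta>) ^ 4 + 6 * (- b * \<delta>)\<^sup>2 * \<tau> + 3 * \<tau>\<^sup>2)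
      + b * ((a * \<delta>) ^ 4 + 6 * (a * \<delta>)\<^sup>2 * \<tau> + 3 * \<tau>\<^sup>2)
      = a * b * (1 - 3 * a * b) * \<delta> ^ 4 + 6 * a * b * \<delta>\<^sup>2 * \<tau> + 3 * \<tau>\<^sup>2"
  unfolding assms by (simp_all add: power2_eq_square power3_eq_cube power4_eq_xxxx algebra_simps)

locale normal_mixture =
  fixes \<alpha>\<^sub>1 \<alpha>\<^sub>2 :: real and A :: "real^'p^'p" and B :: "real^'q^'q" and T\<^sub>1 T\<^sub>2 :: "real^'q^'p"
  assumes \<alpha>1_pos: "0 < \<alpha>\<^sub>1" and \<alpha>1_less_1: "\<alpha>\<^sub>1 < 1" and \<alpha>2: "\<alpha>\<^sub>2 = 1 - \<alpha>\<^sub>1"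
    and A: "sym_pos_def A" and B: "sym_pos_def B"
begin

definition law :: "(real^'q^'p) measure" where
  "law = mixture \<alpha>\<^sub>1 (matrix_normal T\<^sub>1 A B) \<alpha>\<^sub>2 (matrix_normal T\<^sub>2 A B)"

definition mean :: "real^'q^'p" where
  "mean = \<alpha>\<^sub>1 *\<^sub>R T\<^sub>1 + \<alpha>\<^sub>2 *\<^sub>R T\<^sub>2"

definition moment :: "nat \<Rightarrow> (real^'p) \<times> (real^'q) \<Rightarrow> real" where
  "moment k = (\<lambda>(u, v). integral\<^sup>L law (\<lambda>Y. (u \<bullet> ((Y - mean) *v v)) ^ k))"

text \<open>\<open>shift\<close> is the signed gap \<delta> between the projected component means,
  \<open>scale\<close> the common variance \<tau> within the components.\<close>

definition shift :: "(real^'p) \<times> (real^'q) \<Rightarrow> real" where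
  "shift = (\<lambda>(u, v). u \<bullet> ((T\<^sub>2 - T\<^sub>1) *v v))"

definition scale :: "(real^'p) \<times> (real^'q) \<Rightarrow> real" where
  "scale = (\<lambda>(u, v). (u \<bullet> (A *v u)) * (v \<bullet> (B *v v)))"

lemma sets_law [simp, measurable_cong]: "sets law = sets borel"
  by (simp add: law_def)

lemma mean_minus: "T\<^sub>1 - mean = - \<alpha>\<^sub>2 *\<^sub>R (T\<^sub>2 - T\<^sub>1)" "T\<^sub>2 - mean = \<alpha>\<^sub>1 *\<^sub>R (T\<^sub>2 - T\<^sub>1)"
  unfolding mean_def unfolding \<alpha>2 by (simp_all add: algebra_simps)

lemma shift_components:
  "u \<bullet> ((T\<^sub>1 - mean) *v v) = - \<alpha>\<^sub>2 * shift (u, v)" "u \<bullet> ((T\<^sub>2 - mean) *v v) = \<alpha>\<^sub>1 * shift (u, v)"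
  unfolding mean_minus shift_def case_prod_conv scaleR_matrix_vector_assoc[symmetric] inner_scaleR_right
  by simp_all

lemma law_has_integral:
  fixes f :: "real^'q^'p \<Rightarrow> real"
  assumes "has_bochner_integral (matrix_normal T\<^sub>1 A B) f x" "has_bochner_integral (matrix_normal T\<^sub>2 A B) f y"
  shows "has_bochner_integral law f (\<alpha>\<^sub>1 * x + \<alpha>\<^sub>2 * y)"
  unfolding law_def using \<alpha>1_pos \<alpha>1_less_1 \<alpha>2
  by (intro has_bochner_integral_mixture assms) auto

text \<open>A degenerate projection has no normal density and is treated apart. The moment formulas
  then hold for all arguments, including the differences of directions that occur in polarization
  and may vanish.\<close>

lemma moment_zero: "moment k (u, v) = 0 ^ k * integral\<^sup>L law (\<lambda>_. 1)" if "u = 0 \<or> v = 0"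
proof -
  have "u \<bullet> ((Y - mean) *v v) = 0" for Y using that by auto
  then show ?thesis by (simp add: moment_def)
qed

lemma moment_2: "moment 2 (u, v) = \<alpha>\<^sub>1 * \<alpha>\<^sub>2 * (shift (u, v))\<^sup>2 + scale (u, v)"
proof (cases "u = 0 \<or> v = 0")
  case False
  then have "moment 2 (u, v) = \<alpha>\<^sub>1 * ((u \<bullet> ((T\<^sub>1 - mean) *v v))\<^sup>2 + scale (u, v))
      + \<alpha>\<^sub>2 * ((u \<bullet> ((T\<^sub>2 - mean) *v v))\<^sup>2 + scale (u, v))"
    unfolding moment_def scale_def case_prod_conv
    by (intro has_bochner_integral_integral_eq law_has_integral matrix_normal_bilinear_moment_2 A B) auto
  then show ?thesis by (simp only: shift_components two_component_moments(1)[OF \<alpha>2])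
qed (auto simp: moment_zero shift_def scale_def)

lemma moment_3: "moment 3 (u, v) = \<alpha>\<^sub>1 * \<alpha>\<^sub>2 * (\<alpha>\<^sub>1 - \<alpha>\<^sub>2) * (shift (u, v)) ^ 3"
proof (cases "u = 0 \<or> v = 0")
  case False
  let ?a = "u \<bullet> ((T\<^sub>1 - mean) *v v)" and ?b = "u \<bullet> ((T\<^sub>2 - mean) *v v)"
  have "moment 3 (u, v) = \<alpha>\<^sub>1 * (?a ^ 3 + 3 * ?a * scale (u, v)) + \<alpha>\<^sub>2 * (?b ^ 3 + 3 * ?b * scale (u, v))"
    using False unfolding moment_def scale_def case_prod_conv
    by (intro has_bochner_integral_integral_eq law_has_integral matrix_normal_bilinear_moment_3 A B) auto
  then show ?thesis by (simp only: shift_components two_component_moments(2)[OF \<alpha>2])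
qed (auto simp: moment_zero shift_def)

lemma moment_4: "moment 4 (u, v) = \<alpha>\<^sub>1 * \<alpha>\<^sub>2 * (1 - 3 * \<alpha>\<^sub>1 * \<alpha>\<^sub>2) * (shift (u, v)) ^ 4
  + 6 * \<alpha>\<^sub>1 * \<alpha>\<^sub>2 * (shift (u, v))\<^sup>2 * scale (u, v) + 3 * (scale (u, v))\<^sup>2"
proof (cases "u = 0 \<or> v = 0")
  case False
  let ?a = "u \<bullet> ((T\<^sub>1 - mean) *v v)" and ?b = "u \<bullet> ((T\<^sub>2 - mean) *v v)"
  have "moment 4 (u, v) = \<alpha>\<^sub>1 * (?a ^ 4 + 6 * ?a\<^sup>2 * scale (u, v) + 3 * (scale (u, v))\<^sup>2)
      + \<alpha>\<^sub>2 * (?b ^ 4 + 6 * ?b\<^sup>2 * scale (u, v) + 3 * (scale (u, v))\<^sup>2)"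
    using False unfolding moment_def scale_def case_prod_conv
    by (intro has_bochner_integral_integral_eq law_has_integral matrix_normal_bilinear_moment_4 A B) auto
  then show ?thesis by (simp only: shift_components two_component_moments(3)[OF \<alpha>2])
qed (auto simp: moment_zero shift_def scale_def)

lemma integrable_law_entry: "integrable law (\<lambda>Y. ((Y - mean) $ i $ j) ^ k)"
proof -
  have *: "(Y - mean) $ i $ j = axis i 1 \<bullet> ((Y - mean) *v axis j 1)" for Y
    by (simp add: inner_axis' matrix_vector_mult_basis column_def)
  have "axis i (1::real) \<noteq> 0" for i :: "'c::finite" by simp
  then show ?thesis unfolding * law_def using \<alpha>1_pos \<alpha>1_less_1 \<alpha>2
    by (intro integrable_mixture matrix_normal_bilinear_integrable A B) auto
qed

lemma integrable_law_entries_prod: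
  fixes k :: nat
  shows "integrable law (\<lambda>Y. (\<Prod>l<k. (Y - mean) $ fst (f l) $ snd (f l)) ^ j)"
proof (rule integrable_prod_power)
  show "finite_measure law"
    \<comment> \<open>Exponent 0 makes the constant 1 integrable, so the total mass is
      finite.\<close>
    using integrable_law_entry[of _ _ 0] by (intro finite_measureI) (auto simp: integrable_iff_bounded)
  show "(\<lambda>Y. (Y - mean) $ fst (f l) $ snd (f l)) \<in> borel_measurable law" for l
    unfolding measurable_cong_sets[OF sets_law refl]
    by (intro borel_measurable_continuous_onI continuous_intros)
qed (simp_all only: integrable_law_entry finite_lessThan)

lemma moment_1: "moment 1 (u, v) = 0"
proof (cases "u = 0 \<or> v = 0")
  case False
  then have "moment 1 (u, v) = \<alpha>\<^sub>1 * (u \<bullet> ((T\<^sub>1 - mean) *v v)) + \<alpha>\<^sub>2 * (u \<bullet> ((T\<^sub>2 - mean) *v v))"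
    unfolding moment_def case_prod_conv power_one_right
    by (intro has_bochner_integral_integral_eq law_has_integral matrix_normal_bilinear_moment_1 A B) auto
  then show ?thesis unfolding shift_components by simp
qed (auto simp: moment_zero)

end

section \<open>Convergence of sample moments along converging directions\<close>

text \<open>The expansion separates the direction, which enters only the coefficients, from the
  data, which enter only finitely many monomials. Laws of large numbers for these monomials thus
  control all directions at once.\<close>

lemma bilinear_form_power:
  fixes Z :: "real^'q^'p"
  shows "(u \<bullet> (Z *v v)) ^ k = (\<Sum>f \<in> PiE {..<k} (\<lambda>_. UNIV).
    (\<Prod>l<k. u $ fst (f l) * v $ snd (f l)) * (\<Prod>l<k. Z $ fst (f l) $ snd (f l)))"
proof -
  have "(u \<bullet> (Z *v v)) ^ k = (\<Prod>l<k. \<Sum>ij\<in>UNIV. (u $ fst ij * v $ snd ij) * Z $ fst ij $ snd ij)"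
    unfolding inner_mult_outer by simp
  also have "\<dots> = (\<Sum>f \<in> PiE {..<k} (\<lambda>_. UNIV).
      \<Prod>l<k. (u $ fst (f l) * v $ snd (f l)) * Z $ fst (f l) $ snd (f l))"
    by (rule prod_sum_PiE) auto
  finally show ?thesis by (simp only: prod.distrib)
qed

context normal_mixture
begin

definition monomial :: "nat \<Rightarrow> (nat \<Rightarrow> 'p \<times> 'q) \<Rightarrow> real^'q^'p \<Rightarrow> real" where
  "monomial k f Y = (\<Prod>l<k. (Y - mean) $ fst (f l) $ snd (f l))"

text \<open>The event on which the remaining argument is deterministic. It does not mention
  directions and hence also serves directions chosen from the sample. The functions \<open>f\<close>
  are extensional, so there are finitely many for each degree.\<close>

definition monomial_averages_converge :: "(nat \<Rightarrow> real^'q^'p) \<Rightarrow> bool" where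
  "monomial_averages_converge x \<longleftrightarrow> (\<forall>k \<le> 4. \<forall>f \<in> PiE {..<k} (\<lambda>_. UNIV).
     (\<lambda>n. (1 / real n) * (\<Sum>i=1..n. monomial k f (x i))) \<longlonglongrightarrow> integral\<^sup>L law (monomial k f))"

lemma AE_monomial_averages_converge:
  assumes "prob_space M" and ind: "prob_space.indep_vars M (\<lambda>_. borel) X {1..}"
    and "\<And>i. i \<ge> 1 \<Longrightarrow> distr M borel (X i) = law"
  shows "AE \<omega> in M. monomial_averages_converge (\<lambda>i. X i \<omega>)"
proof -
  interpret prob_space M by fact
  have "AE \<omega> in M. (\<lambda>n. (1 / real n) * (\<Sum>i=1..n. monomial k f (X i \<omega>))) \<longlonglongrightarrow> integral\<^sup>L law (monomial k f)"
    for k f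
  proof (rule strong_law_identically_distributed[OF ind assms(3)])
    show "monomial k f \<in> borel_measurable borel"
      unfolding monomial_def[abs_def] by (intro borel_measurable_continuous_onI continuous_intros)
    show "integrable law (\<lambda>Y. monomial k f Y ^ 4)"
      unfolding monomial_def by (rule integrable_law_entries_prod)
  qed
  then have "AE \<omega> in M. \<forall>f \<in> PiE {..<k} (\<lambda>_. UNIV).
      (\<lambda>n. (1 / real n) * (\<Sum>i=1..n. monomial k f (X i \<omega>))) \<longlonglongrightarrow> integral\<^sup>L law (monomial k f)" for k
    by (intro AE_finite_allI finite_PiE) auto
  then show ?thesis
    unfolding monomial_averages_converge_def AE_all_countable by auto
qed

text \<open>The average is a finite sum of coefficients, polynomial in the converging directions,
  times converging monomial averages. Subsequences are included because limit points of the
  maximizers are studied.\<close>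

lemma raw_moment_tendsto:
  assumes x: "monomial_averages_converge x" and "k \<le> 4" and "strict_mono r"
    and un: "un \<longlonglongrightarrow> u" and vn: "vn \<longlonglongrightarrow> v"
  shows "(\<lambda>n. (1 / real (r n)) * (\<Sum>i=1..r n. (un n \<bullet> ((x i - mean) *v vn n)) ^ k)) \<longlonglongrightarrow> moment k (u, v)"
proof -
  let ?F = "PiE {..<k} (\<lambda>_. UNIV) :: (nat \<Rightarrow> 'p \<times> 'q) set"
  let ?c = "\<lambda>u v f. (\<Prod>l<k. u $ fst (f l) * v $ snd (f l)) :: real"
  have int: "integrable law (monomial k f)" for f
    using integrable_law_entries_prod[where k=k and f=f and j=1] by (simp add: monomial_def[abs_def])
  have "(1 / real m) * (\<Sum>i=1..m. (u \<bullet> ((x i - mean) *v v)) ^ k)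
      = (\<Sum>f\<in>?F. ?c u v f * ((1 / real m) * (\<Sum>i=1..m. monomial k f (x i))))" for u v m
    unfolding bilinear_form_power monomial_def[symmetric]
    by (subst sum.swap) (simp add: sum_distrib_left ac_simps)
  moreover have "moment k (u, v) = (\<Sum>f\<in>?F. ?c u v f * integral\<^sup>L law (monomial k f))"
    unfolding moment_def case_prod_conv bilinear_form_power monomial_def[symmetric]
    using int by (subst Bochner_Integration.integral_sum) auto
  moreover have "(\<lambda>n. \<Sum>f\<in>?F. ?c (un n) (vn n) f * ((1 / real (r n)) * (\<Sum>i=1..r n. monomial k f (x i))))
      \<longlonglongrightarrow> (\<Sum>f\<in>?F. ?c u v f * integral\<^sup>L law (monomial k f))"
  proof (intro tendsto_sum tendsto_mult tendsto_prod tendsto_vec_nth un vn)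
    fix f assume "f \<in> ?F"
    then have "(\<lambda>n. (1 / real n) * (\<Sum>i=1..n. monomial k f (x i))) \<longlonglongrightarrow> integral\<^sup>L law (monomial k f)"
      using x \<open>k \<le> 4\<close> unfolding monomial_averages_converge_def by blast
    from LIMSEQ_subseq_LIMSEQ[OF this \<open>strict_mono r\<close>]
    show "(\<lambda>n. (1 / real (r n)) * (\<Sum>i=1..r n. monomial k f (x i))) \<longlonglongrightarrow> integral\<^sup>L law (monomial k f)"
      by (simp add: comp_def)
  qed
  ultimately show ?thesis by simp
qed

text \<open>Replacing \<open>mean\<close> by the sample mean shifts each projection by
  \<open>- R 1\<close>, which tends to 0. In the binomial expansion only the term without a power of
  this shift survives in the limit.\<close>

lemma proj_moment_tendsto:
  assumes x: "monomial_averages_converge x" and "k \<le> 4" and r: "strict_mono r"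
    and un: "un \<longlonglongrightarrow> u" and vn: "vn \<longlonglongrightarrow> v"
  shows "(\<lambda>n. proj_moment x (r n) k (un n, vn n)) \<longlonglongrightarrow> moment k (u, v)"
proof -
  define R where "R j m u v = (1 / real m) * (\<Sum>i=1..m. (u \<bullet> ((x i - mean) *v v)) ^ j)" for j m u v
  have R: "(\<lambda>n. R j (r n) (un n) (vn n)) \<longlonglongrightarrow> moment j (u, v)" if "j \<le> 4" for j
    unfolding R_def by (rule raw_moment_tendsto[OF x that r un vn])
  have R1: "(\<lambda>n. R 1 (r n) (un n) (vn n)) \<longlonglongrightarrow> 0"
    using R[of 1] unfolding moment_1 by simp
  have eq: "proj_moment x m k (u, v) = (\<Sum>j\<le>k. of_nat (k choose j) * R j m u v * (- R 1 m u v) ^ (k - j))"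
    if "m > 0" for m u v
  proof -
    have "u \<bullet> (centred x m i *v v) = u \<bullet> ((x i - mean) *v v) + - R 1 m u v" for i
    proof -
      have "R 1 m u v = u \<bullet> (((1 / real m) *\<^sub>R (\<Sum>i=1..m. x i - mean)) *v v)"
        by (simp add: R_def inner_sum_right sum_matrix_vector_mult flip: scaleR_matrix_vector_assoc)
      also have "(1 / real m) *\<^sub>R (\<Sum>i=1..m. x i - mean) = (1 / real m) *\<^sub>R (\<Sum>i=1..m. x i) - mean"
        using that by (simp add: sum_subtractf scaleR_diff_right sum_constant_scaleR del: sum_constant)
      finally show ?thesis
        by (simp add: centred_def matrix_vector_mult_diff_rdistrib inner_diff_right)
    qed
    then have "proj_moment x m k (u, v) = (1 / real m) * (\<Sum>i=1..m. \<Sum>j\<le>k.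
        of_nat (k choose j) * (u \<bullet> ((x i - mean) *v v)) ^ j * (- R 1 m u v) ^ (k - j))"
      by (simp only: proj_moment_def case_prod_conv binomial_ring)
    also have "\<dots> = (\<Sum>j\<le>k. of_nat (k choose j) * R j m u v * (- R 1 m u v) ^ (k - j))"
      unfolding R_def[of j for j] by (subst sum.swap) (simp add: sum_distrib_left sum_distrib_right ac_simps)
    finally show ?thesis .
  qed
  have "(\<lambda>n. \<Sum>j\<le>k. of_nat (k choose j) * R j (r n) (un n) (vn n) * (- R 1 (r n) (un n) (vn n)) ^ (k - j))
     \<longlonglongrightarrow> (\<Sum>j\<le>k. of_nat (k choose j) * moment j (u, v) * (- 0) ^ (k - j))"
    using \<open>k \<le> 4\<close> by (intro tendsto_intros R R1) auto
  \<comment> \<open>A power of 0 vanishes unless its exponent is 0, which leaves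
    \<open>j = k\<close>.\<close>
  also have "(\<Sum>j\<le>k. of_nat (k choose j) * moment j (u, v) * (- 0) ^ (k - j)) = (\<Sum>j\<in>{k}. moment j (u, v))"
    by (rule sum.mono_neutral_cong_right) (auto simp: power_0_left)
  finally have lim: "(\<lambda>n. \<Sum>j\<le>k. of_nat (k choose j) * R j (r n) (un n) (vn n) * (- R 1 (r n) (un n) (vn n)) ^ (k - j))
     \<longlonglongrightarrow> moment k (u, v)" by simp
  have "eventually (\<lambda>n. (\<Sum>j\<le>k. of_nat (k choose j) * R j (r n) (un n) (vn n) * (- R 1 (r n) (un n) (vn n)) ^ (k - j))
      = proj_moment x (r n) k (un n, vn n)) sequentially"
    using eventually_gt_at_top[of 0]
  proof eventually_elim
    case (elim n)
    then have "r n > 0" using seq_suble[OF r, of n] by simp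
    then show ?case by (rule eq[symmetric])
  qed
  then show ?thesis by (rule Lim_transform_eventually[OF lim])
qed

end

section \<open>Limits of constrained maximizers\<close>

text \<open>Convergent subsequences are extracted successively, one index after the other; earlier
  limits persist along further subsequences.\<close>

lemma finite_family_convergent_subseq:
  fixes f :: "nat \<Rightarrow> 'j \<Rightarrow> 'a::metric_space"
  assumes "finite J" and "compact C" and "\<And>n j. j \<in> J \<Longrightarrow> f n j \<in> C"
  shows "\<exists>r l. strict_mono r \<and> (\<forall>j\<in>J. l j \<in> C \<and> (\<lambda>n. f (r n) j) \<longlonglongrightarrow> l j)"
  using assms(1,3)
proof (induction J rule: finite_induct)
  case empty
  show ?case by (intro exI[of _ id]) (auto simp: strict_mono_def)
next
  case (insert j J)
  then obtain r l where r: "strict_mono r" "\<And>j. j \<in> J \<Longrightarrow> l j \<in> C"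
    "\<And>j. j \<in> J \<Longrightarrow> (\<lambda>n. f (r n) j) \<longlonglongrightarrow> l j"
    by (metis insertCI)
  have "\<forall>n. f (r n) j \<in> C" using insert.prems by blast
  then obtain c s where s: "c \<in> C" "strict_mono s" "((\<lambda>n. f (r n) j) \<circ> s) \<longlonglongrightarrow> c"
    using compact_imp_seq_compact[OF \<open>compact C\<close>] unfolding seq_compact_def by metis
  have "(\<lambda>n. f ((r \<circ> s) n) i) \<longlonglongrightarrow> l i" if "i \<in> J" for i
    using LIMSEQ_subseq_LIMSEQ[OF r(3)[OF that] s(2)] by (simp add: comp_def)
  then show ?case
    using r(2) s strict_mono_o[OF r(1) s(2)] insert.hyps
    by (intro exI[of _ "r \<circ> s"] exI[of _ "l(j := c)"]) (auto simp: comp_def)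
qed

lemma tendsto_if_subseq_tendsto:
  fixes f :: "nat \<Rightarrow> 'a::metric_space"
  assumes "\<And>r :: nat \<Rightarrow> nat. strict_mono r \<Longrightarrow> \<exists>s. strict_mono s \<and> (\<lambda>n :: nat. f (r (s n))) \<longlonglongrightarrow> l"
  shows "f \<longlonglongrightarrow> l"
proof (rule ccontr)
  assume "\<not> f \<longlonglongrightarrow> l"
  then obtain e where e: "e > 0" "\<not> eventually (\<lambda>n. dist (f n) l < e) sequentially"
    by (auto simp: tendsto_iff)
  from not_eventually_sequentiallyD[OF e(2)] obtain r :: "nat \<Rightarrow> nat"
    where r: "strict_mono r" "\<And>n. \<not> dist (f (r n)) l < e" by blast
  obtain s where "(\<lambda>n. f (r (s n))) \<longlonglongrightarrow> l" using assms[OF r(1)] by blast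
  then have "eventually (\<lambda>n. dist (f (r (s n))) l < e) sequentially" using e(1) by (rule tendstoD)
  then show False using r(2) by (simp add: eventually_sequentially)
qed

text \<open>A point of the limiting constraint space is a limit of feasible points: the violation of
  the \<open>k\<close>-th constraint is corrected along a feasible perturbation of \<open>e k\<close>.\<close>
lemma feasible_approximation:
  fixes h :: "nat \<Rightarrow> nat \<Rightarrow> 'a::real_normed_vector \<Rightarrow> real"
  assumes lin: "\<And>n k. linear (h n k)"
    and conv: "\<And>k y x. 1 \<le> k \<Longrightarrow> k < j \<Longrightarrow> y \<longlonglongrightarrow> x \<Longrightarrow> (\<lambda>n. h n k (y n)) \<longlonglongrightarrow> H k x"
    and e0: "\<And>k l. 1 \<le> l \<Longrightarrow> l < k \<Longrightarrow> k < j \<Longrightarrow> H l (e k) = 0"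
    and e1: "\<And>k. 1 \<le> k \<Longrightarrow> k < j \<Longrightarrow> H k (e k) \<noteq> 0"
    and "\<And>k. 1 \<le> k \<Longrightarrow> k < j \<Longrightarrow> H k x = 0"
  shows "\<exists>y. y \<longlonglongrightarrow> x \<and> (\<forall>k\<in>{1..<j}. \<forall>\<^sub>F n in sequentially. h n k (y n) = 0)"
  using conv e0 e1 assms(5)
proof (induction j arbitrary: x)
  case 0
  show ?case by (intro exI[of _ "\<lambda>_. x"]) auto
next
  case (Suc j)
  have IH: "\<exists>y. y \<longlonglongrightarrow> x' \<and> (\<forall>k\<in>{1..<j}. \<forall>\<^sub>F n in sequentially. h n k (y n) = 0)"
    if "\<And>k. 1 \<le> k \<Longrightarrow> k < j \<Longrightarrow> H k x' = 0" for x'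
  proof (rule Suc.IH)
    show "(\<lambda>n. h n k (y n)) \<longlonglongrightarrow> H k z" if "1 \<le> k" "k < j" "y \<longlonglongrightarrow> z" for k y z
      using Suc.prems(1)[of k y z] that by simp
    show "H l (e k) = 0" if "1 \<le> l" "l < k" "k < j" for k l using Suc.prems(2)[of l k] that by simp
    show "H k (e k) \<noteq> 0" if "1 \<le> k" "k < j" for k using Suc.prems(3)[of k] that by simp
  qed (rule that)
  have "H k x = 0" if "1 \<le> k" "k < j" for k using Suc.prems(4)[of k] that by simp
  from IH[OF this] obtain y where y: "y \<longlonglongrightarrow> x" "\<And>k. k \<in> {1..<j} \<Longrightarrow> \<forall>\<^sub>F n in sequentially. h n k (y n) = 0"
    by blast
  show ?case
  proof (cases "j = 0")
    case True
    then show ?thesis using y by (intro exI[of _ y]) auto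
  next
    case False
    then have j: "1 \<le> j" "j < Suc j" by auto
    \<comment> \<open>By the triangular condition on the \<open>e k\<close>, the vector
      \<open>e j\<close> satisfies all earlier limiting constraints, so it too has approximants
      \<open>z n\<close> obeying the earlier constraints. Moving \<open>y n\<close> along them
      repairs constraint \<open>j\<close> without disturbing the others; the step size tends to
      0.\<close>
    have "H k (e j) = 0" if "1 \<le> k" "k < j" for k using Suc.prems(2)[of k j] that by simp
    from IH[OF this] obtain z where z: "z \<longlonglongrightarrow> e j"
      "\<And>k. k \<in> {1..<j} \<Longrightarrow> \<forall>\<^sub>F n in sequentially. h n k (z n) = 0"
      by blast
    let ?t = "\<lambda>n. h n j (y n) / h n j (z n)"
    have hy: "(\<lambda>n. h n j (y n)) \<longlonglongrightarrow> 0" using Suc.prems(1)[OF j y(1)] Suc.prems(4)[OF j] by simp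
    have hz: "(\<lambda>n. h n j (z n)) \<longlonglongrightarrow> H j (e j)" by (rule Suc.prems(1)[OF j z(1)])
    have "(\<lambda>n. y n - ?t n *\<^sub>R z n) \<longlonglongrightarrow> x - (0 / H j (e j)) *\<^sub>R e j"
      using Suc.prems(3)[OF j] by (intro tendsto_intros y z hy hz)
    then have lim: "(\<lambda>n. y n - ?t n *\<^sub>R z n) \<longlonglongrightarrow> x" by simp
    have step: "h n k (y n - ?t n *\<^sub>R z n) = h n k (y n) - ?t n * h n k (z n)" for n k
      using lin[of n k] by (simp add: linear_diff linear_scale)
    have "\<forall>\<^sub>F n in sequentially. h n k (y n - ?t n *\<^sub>R z n) = 0" if "k \<in> {1..<Suc j}" for k
    proof (cases "k = j")
      case True
      have "\<forall>\<^sub>F n in sequentially. h n j (z n) \<noteq> 0"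
        using hz Suc.prems(3)[OF j] by (rule tendsto_imp_eventually_ne)
      then show ?thesis by eventually_elim (simp add: step True)
    next
      case False
      then have "k \<in> {1..<j}" using that by auto
      from y(2)[OF this] z(2)[OF this] show ?thesis by eventually_elim (simp add: step)
    qed
    with lim show ?thesis by blast
  qed
qed

section \<open>Constraints as polarized second moments\<close>

lemma linear_inner_left_const: "linear (\<lambda>x. x \<bullet> c)"
  by (intro bounded_linear.linear bounded_linear_intros)

text \<open>The left side is the empirical cross moment of the projections along \<open>u'\<close>
  and \<open>u\<close> with common \<open>v\<close>. Polarization reduces it to second moments,
  whose convergence is known.\<close>

lemma G1_bilinear:
  "u' \<bullet> (G1 x n (u, v) *v u) = (proj_moment x n 2 (u' + u, v) - proj_moment x n 2 (u' - u, v)) / 4"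
proof -
  have "G1 x n (u, v) *v u = (1 / real n) *\<^sub>R (\<Sum>i=1..n. (u \<bullet> (centred x n i *v v)) *\<^sub>R (centred x n i *v v))"
    unfolding G1_def case_prod_conv
    by (simp add: sum_matrix_vector_mult outer_vector_mult matrix_vector_mult_scaleR dot_lmul_matrix
        inner_commute[of v] flip: scaleR_matrix_vector_assoc matrix_vector_mul_assoc)
  then have "u' \<bullet> (G1 x n (u, v) *v u) = (1 / real n) * (\<Sum>i=1..n. (u \<bullet> (centred x n i *v v)) * (u' \<bullet> (centred x n i *v v)))"
    by (simp add: inner_sum_right)
  also have "\<dots> = (proj_moment x n 2 (u' + u, v) - proj_moment x n 2 (u' - u, v)) / 4"
    unfolding proj_moment_def case_prod_conv right_diff_distrib[symmetric] sum_subtractf[symmetric]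
    by (simp add: inner_add_left inner_diff_left power2_eq_square algebra_simps sum_divide_distrib
        sum_distrib_left)
  finally show ?thesis .
qed

lemma inner_transpose_mult: "x \<bullet> (transpose Y *v y) = y \<bullet> (Y *v x)" for Y :: "real^'n^'m"
  by (metis inner_commute inner_matrix_transpose)

text \<open>The counterpart with the roles of rows and columns exchanged.\<close>

lemma G2_bilinear:
  "v' \<bullet> (G2 x n (u, v) *v v) = (proj_moment x n 2 (u, v' + v) - proj_moment x n 2 (u, v' - v)) / 4"
proof -
  have "G2 x n (u, v) *v v = (1 / real n) *\<^sub>R (\<Sum>i=1..n. (u \<bullet> (centred x n i *v v)) *\<^sub>R (transpose (centred x n i) *v u))"
    unfolding G2_def case_prod_conv
    by (simp add: sum_matrix_vector_mult outer_vector_mult matrix_vector_mult_scaleR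
        flip: scaleR_matrix_vector_assoc matrix_vector_mul_assoc del: transpose_matrix_vector)
  then have "v' \<bullet> (G2 x n (u, v) *v v) = (1 / real n) * (\<Sum>i=1..n. (u \<bullet> (centred x n i *v v)) * (u \<bullet> (centred x n i *v v')))"
    by (simp add: inner_sum_right inner_transpose_mult del: transpose_matrix_vector)
  also have "\<dots> = (proj_moment x n 2 (u, v' + v) - proj_moment x n 2 (u, v' - v)) / 4"
    unfolding proj_moment_def case_prod_conv right_diff_distrib[symmetric] sum_subtractf[symmetric]
    by (simp add: matrix_vector_right_distrib matrix_vector_mult_diff_distrib inner_add_right
        inner_diff_right power2_eq_square algebra_simps sum_divide_distrib sum_distrib_left)
  finally show ?thesis .
qed

section \<open>Population kurtosis in whitened coordinates\<close>

locale discriminant_mixture = normal_mixture \<alpha>\<^sub>1 \<alpha>\<^sub>2 A B T\<^sub>1 T\<^sub>2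
  for \<alpha>\<^sub>1 \<alpha>\<^sub>2 :: real and A :: "real^'p^'p" and B :: "real^'q^'q" and T\<^sub>1 T\<^sub>2 :: "real^'q^'p" +
  assumes product_less: "6 * (\<alpha>\<^sub>1 * \<alpha>\<^sub>2) < 1"
begin

abbreviation \<beta> :: real where "\<beta> \<equiv> \<alpha>\<^sub>1 * \<alpha>\<^sub>2"

abbreviation S :: "real^'p^'p" where "S \<equiv> mat_sqrt A"

abbreviation R :: "real^'q^'q" where "R \<equiv> mat_sqrt B"

definition D :: "real^'q^'p" where "D = matrix_inv S ** (T\<^sub>2 - T\<^sub>1) ** matrix_inv R"

definition ratio :: "(real^'p) \<times> (real^'q) \<Rightarrow> real" where
  "ratio w = (shift w)\<^sup>2 / scale w"

definition kurtosis :: "(real^'p) \<times> (real^'q) \<Rightarrow> real" where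
  "kurtosis w = moment 4 w / (moment 2 w)\<^sup>2"

lemma \<beta>_pos: "0 < \<beta>"
  using \<alpha>1_pos \<alpha>1_less_1 \<alpha>2 by simp

lemma \<alpha>_neq: "\<alpha>\<^sub>1 \<noteq> \<alpha>\<^sub>2"
proof
  assume "\<alpha>\<^sub>1 = \<alpha>\<^sub>2"
  then have "\<alpha>\<^sub>1 = 1 / 2" "\<alpha>\<^sub>2 = 1 / 2" using \<alpha>2 by auto
  then have "6 * \<beta> = 6 * ((1 / 2) * (1 / 2))" by metis
  then show False using product_less by simp
qed

lemma S: "sym_pos_def S" "S ** S = A" and R: "sym_pos_def R" "R ** R = B"
  using mat_sqrt A B by auto

lemma S_symmetric: "x \<bullet> (S *v y) = (S *v x) \<bullet> y"
  using S(1) by (metis inner_matrix_transpose sym_pos_def_def)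

lemma R_symmetric: "x \<bullet> (R *v y) = (R *v x) \<bullet> y"
  using R(1) by (metis inner_matrix_transpose sym_pos_def_def)

lemma S_eq_0_iff [simp]: "S *v x = 0 \<longleftrightarrow> x = 0"
  using S(1) unfolding sym_pos_def_def by (metis inner_zero_right less_irrefl matrix_vector_mult_0_right)

lemma R_eq_0_iff [simp]: "R *v x = 0 \<longleftrightarrow> x = 0"
  using R(1) unfolding sym_pos_def_def by (metis inner_zero_right less_irrefl matrix_vector_mult_0_right)

lemma S_inv: "S ** matrix_inv S = mat 1" "matrix_inv S ** S = mat 1"
  and R_inv: "R ** matrix_inv R = mat 1" "matrix_inv R ** R = mat 1"
  using matrix_inv_mult sym_pos_def_invertible S(1) R(1) by auto

lemma difference_eq: "T\<^sub>2 - T\<^sub>1 = S ** D ** R"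
proof -
  have "S ** D ** R = (S ** matrix_inv S) ** (T\<^sub>2 - T\<^sub>1) ** (matrix_inv R ** R)"
    by (simp add: D_def matrix_mul_assoc)
  then show ?thesis by (simp add: S_inv R_inv)
qed

lemma shift_eq: "shift (u, v) = (S *v u) \<bullet> (D *v (R *v v))"
  unfolding shift_def difference_eq by (simp add: S_symmetric flip: matrix_vector_mul_assoc)

lemma A_inner: "x \<bullet> (A *v y) = (S *v x) \<bullet> (S *v y)"
proof -
  have "A *v y = S *v (S *v y)" by (simp only: matrix_vector_mul_assoc S(2))
  then show ?thesis by (simp add: S_symmetric)
qed

lemma B_inner: "x \<bullet> (B *v y) = (R *v x) \<bullet> (R *v y)"
proof -
  have "B *v y = R *v (R *v y)" by (simp only: matrix_vector_mul_assoc R(2))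
  then show ?thesis by (simp add: R_symmetric)
qed

lemma scale_eq: "scale (u, v) = (norm (S *v u))\<^sup>2 * (norm (R *v v))\<^sup>2"
  by (simp add: scale_def A_inner B_inner power2_norm_eq_inner)

lemma scale_pos: "u \<noteq> 0 \<Longrightarrow> v \<noteq> 0 \<Longrightarrow> scale (u, v) > 0"
  by (simp add: scale_eq)

text \<open>The ratio is invariant under rescaling of both directions, so only the normalized
  whitened directions matter.\<close>

lemma ratio_eq:
  assumes "S *v u = c *\<^sub>R x" "R *v v = c' *\<^sub>R y" "c \<noteq> 0" "c' \<noteq> 0" "norm x = 1" "norm y = 1"
  shows "ratio (u, v) = (x \<bullet> (D *v y))\<^sup>2"
  using assms by (simp add: ratio_def shift_eq scale_eq matrix_vector_mult_scaleR power_mult_distrib)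

lemma ratio_nonneg: "ratio w \<ge> 0"
  by (cases w) (simp add: ratio_def scale_eq)

lemma moment_2_eq: "u \<noteq> 0 \<Longrightarrow> v \<noteq> 0 \<Longrightarrow> moment 2 (u, v) = scale (u, v) * (1 + \<beta> * ratio (u, v))"
  using scale_pos[of u v] by (simp add: moment_2 ratio_def field_simps)

lemma denominator_pos: "1 + \<beta> * ratio w > 0"
  using \<beta>_pos ratio_nonneg[of w] by (simp add: add_pos_nonneg)

lemma moment_2_pos: "u \<noteq> 0 \<Longrightarrow> v \<noteq> 0 \<Longrightarrow> moment 2 (u, v) > 0"
  by (simp add: moment_2_eq scale_pos denominator_pos)

text \<open>After cancelling the squared variance, the numerator is three times the squared
  denominator \<open>1 + \<beta> * ratio (u, v)\<close> plus the excess
  \<open>\<beta> * (1 - 6 * \<beta>)\<close> times the squared ratio.\<close>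

lemma kurtosis_eq:
  assumes "u \<noteq> 0" "v \<noteq> 0"
  shows "kurtosis (u, v) = 3 + \<beta> * (1 - 6 * \<beta>) * (ratio (u, v) / (1 + \<beta> * ratio (u, v)))\<^sup>2"
proof -
  let ?t = "scale (u, v)" and ?r = "ratio (u, v)"
  have t: "?t > 0" using scale_pos assms .
  have "(shift (u, v))\<^sup>2 = ?r * ?t" using t by (simp add: ratio_def)
  moreover from this have "(shift (u, v)) ^ 4 = (?r * ?t)\<^sup>2" using power_mult[of "shift (u, v)" 2 2] by simp
  ultimately have "moment 4 (u, v) = ?t\<^sup>2 * (\<beta> * (1 - 3 * \<beta>) * ?r\<^sup>2 + 6 * \<beta> * ?r + 3)"
    by (simp add: moment_4 power_mult_distrib power2_eq_square algebra_simps)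
  then have "kurtosis (u, v) = (\<beta> * (1 - 3 * \<beta>) * ?r\<^sup>2 + 6 * \<beta> * ?r + 3) / (1 + \<beta> * ?r)\<^sup>2"
    using t by (simp add: kurtosis_def moment_2_eq assms power_mult_distrib)
  moreover have "\<beta> * (1 - 3 * \<beta>) * ?r\<^sup>2 + 6 * \<beta> * ?r + 3 = 3 * (1 + \<beta> * ?r)\<^sup>2 + \<beta> * (1 - 6 * \<beta>) * ?r\<^sup>2"
    by (simp add: power2_eq_square algebra_simps)
  ultimately show ?thesis using denominator_pos[of "(u, v)"]
    by (simp add: add_divide_distrib power_divide)
qed

text \<open>The excess has a positive factor because \<open>6 * \<beta> < 1\<close>, and \<rho> / (1
  + \<beta> \<rho>) is increasing for \<rho> \<ge> 0: after cross-multiplication the mixed products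
  cancel.\<close>

lemma ratio_le_if_kurtosis_le:
  assumes "u \<noteq> 0" "v \<noteq> 0" "u' \<noteq> 0" "v' \<noteq> 0" and le: "kurtosis (u, v) \<le> kurtosis (u', v')"
  shows "ratio (u, v) \<le> ratio (u', v')"
proof -
  let ?r = "ratio (u, v)" and ?r' = "ratio (u', v')"
  have "\<beta> * (1 - 6 * \<beta>) > 0" using \<beta>_pos product_less by (intro mult_pos_pos[of \<beta>]) simp_all
  then have "(?r / (1 + \<beta> * ?r))\<^sup>2 \<le> (?r' / (1 + \<beta> * ?r'))\<^sup>2"
    using le unfolding kurtosis_eq[OF assms(1,2)] kurtosis_eq[OF assms(3,4)] add_le_cancel_left
    by (subst (asm) mult_le_cancel_left_pos)
  moreover have "?r' / (1 + \<beta> * ?r') \<ge> 0"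
    by (intro divide_nonneg_pos ratio_nonneg denominator_pos)
  ultimately have "?r / (1 + \<beta> * ?r) \<le> ?r' / (1 + \<beta> * ?r')" by (rule power2_le_imp_le)
  then have "?r * (1 + \<beta> * ?r') \<le> ?r' * (1 + \<beta> * ?r)"
    by (simp only: pos_divide_le_eq[OF denominator_pos] times_divide_eq_left
        pos_le_divide_eq[OF denominator_pos])
  then show ?thesis by (simp add: algebra_simps)
qed

text \<open>The population counterpart of the constraint on \<open>u\<close>, expressed in whitened
  coordinates: covariance between the component means plus covariance within the components.\<close>

lemma polarized_moment_left:
  "(moment 2 (u' + u, v) - moment 2 (u' - u, v)) / 4
    = \<beta> * ((S *v u') \<bullet> (D *v (R *v v))) * ((S *v u) \<bullet> (D *v (R *v v)))
      + ((S *v u') \<bullet> (S *v u)) * (norm (R *v v))\<^sup>2"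
proof -
  define p q y where "p = S *v u'" and "q = S *v u" and "y = D *v (R *v v)"
  have "moment 2 (u' + u, v) = \<beta> * ((p + q) \<bullet> y)\<^sup>2 + ((p + q) \<bullet> (p + q)) * (norm (R *v v))\<^sup>2"
    by (simp add: moment_2 shift_eq scale_eq p_def q_def y_def matrix_vector_right_distrib power2_norm_eq_inner)
  moreover have "moment 2 (u' - u, v) = \<beta> * ((p - q) \<bullet> y)\<^sup>2 + ((p - q) \<bullet> (p - q)) * (norm (R *v v))\<^sup>2"
    by (simp add: moment_2 shift_eq scale_eq p_def q_def y_def matrix_vector_mult_diff_distrib power2_norm_eq_inner)
  ultimately show ?thesis unfolding p_def[symmetric] q_def[symmetric] y_def[symmetric]
    by (simp add: inner_add_left inner_add_right inner_diff_left inner_diff_right inner_commute[of q p]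
        power2_eq_square algebra_simps)
qed

lemma polarized_moment_right:
  "(moment 2 (u, v' + v) - moment 2 (u, v' - v)) / 4
    = \<beta> * ((S *v u) \<bullet> (D *v (R *v v'))) * ((S *v u) \<bullet> (D *v (R *v v)))
      + ((R *v v') \<bullet> (R *v v)) * (norm (S *v u))\<^sup>2"
proof -
  define p q y where "p = R *v v'" and "q = R *v v" and "y = S *v u"
  have "moment 2 (u, v' + v) = \<beta> * (y \<bullet> (D *v p) + y \<bullet> (D *v q))\<^sup>2 + ((p + q) \<bullet> (p + q)) * (norm y)\<^sup>2"
    by (simp add: moment_2 shift_eq scale_eq p_def q_def y_def matrix_vector_right_distrib inner_add_right
        power2_norm_eq_inner)
  moreover have "moment 2 (u, v' - v) = \<beta> * (y \<bullet> (D *v p) - y \<bullet> (D *v q))\<^sup>2 + ((p - q) \<bullet> (p - q)) * (norm y)\<^sup>2"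
    by (simp add: moment_2 shift_eq scale_eq p_def q_def y_def matrix_vector_mult_diff_distrib inner_diff_right
        power2_norm_eq_inner)
  ultimately show ?thesis unfolding p_def[symmetric] q_def[symmetric] y_def[symmetric]
    by (simp add: inner_add_left inner_add_right inner_diff_left inner_diff_right inner_commute[of q p]
        power2_eq_square algebra_simps)
qed

section \<open>Convergence of the discriminant weights\<close>

lemma sample_kurtosis_tendsto:
  assumes "monomial_averages_converge x" "strict_mono r" "un \<longlonglongrightarrow> u" "vn \<longlonglongrightarrow> v" "u \<noteq> 0" "v \<noteq> 0"
  shows "(\<lambda>n. sample_kurtosis x (r n) (un n, vn n)) \<longlonglongrightarrow> kurtosis (u, v)"
  unfolding sample_kurtosis_def kurtosis_def
  using assms moment_2_pos[of u v] by (intro tendsto_intros proj_moment_tendsto) auto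

definition coefficient :: "(nat \<Rightarrow> real^'q^'p) \<Rightarrow> nat \<Rightarrow> (real^'p) \<times> (real^'q) \<Rightarrow> real" where
  "coefficient x n w = lda_sign \<alpha>\<^sub>1 \<alpha>\<^sub>2 x n w * proj_moment x n 2 w powr (- 1 / 2)
          * lambda \<alpha>\<^sub>1 \<alpha>\<^sub>2 x n w * sqrt (1 + \<alpha>\<^sub>1 * \<alpha>\<^sub>2 * (lambda \<alpha>\<^sub>1 \<alpha>\<^sub>2 x n w)\<^sup>2)"

text \<open>With \<rho> the ratio, \<open>theta\<close> tends to \<rho> / (1 + \<beta> \<rho>), so
  \<open>lambda\<close> tends to the square root of \<rho>. The second moment is \<tau> (1 + \<beta>
  \<rho>), whose second factor cancels against the last square root of the weight. What remains is
  sgn \<delta> times the absolute value of \<delta>, divided by \<tau>.\<close>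

lemma coefficient_tendsto:
  assumes x: "monomial_averages_converge x" and r: "strict_mono r"
    and un: "un \<longlonglongrightarrow> u" and vn: "vn \<longlonglongrightarrow> v" and uv: "u \<noteq> 0" "v \<noteq> 0" and shift: "shift (u, v) \<noteq> 0"
  shows "(\<lambda>n. coefficient x (r n) (un n, vn n)) \<longlonglongrightarrow> shift (u, v) / scale (u, v)"
proof -
  let ?\<rho> = "ratio (u, v)" and ?t = "scale (u, v)"
  define \<theta> where "\<theta> = ?\<rho> / (1 + \<beta> * ?\<rho>)"
  have den: "1 + \<beta> * ?\<rho> > 0" by (rule denominator_pos)
  have \<theta>0: "\<theta> \<ge> 0" using den ratio_nonneg by (simp add: \<theta>_def)
  have bb: "\<beta> * (1 - 6 * \<alpha>\<^sub>1 * \<alpha>\<^sub>2) \<noteq> 0"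
    using \<alpha>1_pos \<alpha>1_less_1 \<alpha>2 product_less by (simp add: mult.assoc)
  have "(\<lambda>n. theta \<alpha>\<^sub>1 \<alpha>\<^sub>2 x (r n) (un n, vn n))
      \<longlonglongrightarrow> sqrt (max ((kurtosis (u, v) - 3) / (\<beta> * (1 - 6 * \<alpha>\<^sub>1 * \<alpha>\<^sub>2))) 0)"
    unfolding theta_def
    by (intro tendsto_real_sqrt tendsto_max tendsto_divide tendsto_diff tendsto_const bb
        sample_kurtosis_tendsto[OF x r un vn uv])
  moreover have "(kurtosis (u, v) - 3) / (\<beta> * (1 - 6 * \<alpha>\<^sub>1 * \<alpha>\<^sub>2)) = \<theta>\<^sup>2"
    using bb by (simp add: kurtosis_eq uv \<theta>_def mult.assoc)
  ultimately have lim_theta: "(\<lambda>n. theta \<alpha>\<^sub>1 \<alpha>\<^sub>2 x (r n) (un n, vn n)) \<longlonglongrightarrow> \<theta>"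
    using \<theta>0 by (simp add: max_absorb1)
  have \<theta>1: "1 - \<beta> * \<theta> = 1 / (1 + \<beta> * ?\<rho>)" using den by (simp add: \<theta>_def field_simps)
  then have \<theta>2: "1 - \<beta> * \<theta> \<noteq> 0" and \<theta>\<rho>: "\<theta> / (1 - \<beta> * \<theta>) = ?\<rho>" using den by (auto simp: \<theta>_def)
  have "(\<lambda>n. sqrt (max (theta \<alpha>\<^sub>1 \<alpha>\<^sub>2 x (r n) (un n, vn n) / (1 - \<beta> * theta \<alpha>\<^sub>1 \<alpha>\<^sub>2 x (r n) (un n, vn n))) 0))
      \<longlonglongrightarrow> sqrt (max (\<theta> / (1 - \<beta> * \<theta>)) 0)"
    by (intro tendsto_real_sqrt tendsto_max tendsto_divide tendsto_diff tendsto_mult tendsto_const lim_theta \<theta>2)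
  moreover have "\<forall>\<^sub>F n in sequentially. sqrt (max (theta \<alpha>\<^sub>1 \<alpha>\<^sub>2 x (r n) (un n, vn n) / (1 - \<beta> * theta \<alpha>\<^sub>1 \<alpha>\<^sub>2 x (r n) (un n, vn n))) 0)
      = lambda \<alpha>\<^sub>1 \<alpha>\<^sub>2 x (r n) (un n, vn n)"
  proof -
    \<comment> \<open>The limit of this denominator is nonzero, so the default value 0 of
      \<open>lambda\<close> is eventually not taken.\<close>
    have "(\<lambda>n. 1 - \<beta> * theta \<alpha>\<^sub>1 \<alpha>\<^sub>2 x (r n) (un n, vn n)) \<longlonglongrightarrow> 1 - \<beta> * \<theta>"
      by (intro tendsto_intros lim_theta)
    from tendsto_imp_eventually_ne[OF this \<theta>2] show ?thesis
      by eventually_elim (simp add: lambda_def Let_def)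
  qed
  ultimately have "(\<lambda>n. lambda \<alpha>\<^sub>1 \<alpha>\<^sub>2 x (r n) (un n, vn n)) \<longlonglongrightarrow> sqrt (max (\<theta> / (1 - \<beta> * \<theta>)) 0)"
    by (rule Lim_transform_eventually)
  then have lim_lambda: "(\<lambda>n. lambda \<alpha>\<^sub>1 \<alpha>\<^sub>2 x (r n) (un n, vn n)) \<longlonglongrightarrow> sqrt ?\<rho>"
    unfolding \<theta>\<rho> by (simp add: max_absorb1 ratio_nonneg)
  have m2: "moment 2 (u, v) > 0" using moment_2_pos uv .
  have "(\<lambda>n. inverse (\<alpha>\<^sub>1 - \<alpha>\<^sub>2) * proj_moment x (r n) 3 (un n, vn n)) \<longlonglongrightarrow> inverse (\<alpha>\<^sub>1 - \<alpha>\<^sub>2) * moment 3 (u, v)"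
    by (intro tendsto_mult tendsto_const proj_moment_tendsto[OF x _ r un vn]) simp
  \<comment> \<open>The third moment carries the factor
    \<open>\<alpha>\<^sub>1 - \<alpha>\<^sub>2\<close>; dividing by it leaves an odd power of the
    gap with a positive factor. The gap is nonzero, so \<open>sgn\<close> is continuous at the
    limit.\<close>
  also have "inverse (\<alpha>\<^sub>1 - \<alpha>\<^sub>2) * moment 3 (u, v) = \<beta> * shift (u, v) ^ 3"
    using \<alpha>_neq by (simp add: moment_3)
  finally have "(\<lambda>n. lda_sign \<alpha>\<^sub>1 \<alpha>\<^sub>2 x (r n) (un n, vn n)) \<longlonglongrightarrow> sgn (\<beta> * shift (u, v) ^ 3)"
    unfolding lda_sign_def using \<beta>_pos shift by (intro tendsto_sgn) auto
  also have "sgn (\<beta> * shift (u, v) ^ 3) = sgn (shift (u, v))"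
    by (simp only: sgn_mult[of \<beta>] sgn_pos[OF \<beta>_pos]) (auto simp: sgn_if zero_less_power_eq)
  finally have lim: "(\<lambda>n. coefficient x (r n) (un n, vn n)) \<longlonglongrightarrow> sgn (shift (u, v)) * moment 2 (u, v) powr (- 1 / 2)
      * sqrt ?\<rho> * sqrt (1 + \<beta> * (sqrt ?\<rho>)\<^sup>2)"
    unfolding coefficient_def using m2
    by (intro tendsto_mult tendsto_powr tendsto_real_sqrt tendsto_add tendsto_power tendsto_const lim_lambda
        proj_moment_tendsto[OF x _ r un vn]) auto
  have "sgn (shift (u, v)) * moment 2 (u, v) powr (- 1 / 2) * sqrt ?\<rho> * sqrt (1 + \<beta> * (sqrt ?\<rho>)\<^sup>2)
      = shift (u, v) / ?t"
  proof -
    have t: "?t > 0" using scale_pos uv .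
    have "moment 2 (u, v) powr (- 1 / 2) = 1 / (sqrt ?t * sqrt (1 + \<beta> * ?\<rho>))"
      using m2 by (simp add: powr_minus_divide powr_half_sqrt moment_2_eq uv real_sqrt_mult)
    moreover have "sqrt ?\<rho> = \<bar>shift (u, v)\<bar> / sqrt ?t"
      by (simp add: ratio_def real_sqrt_divide)
    moreover have "(sqrt ?\<rho>)\<^sup>2 = ?\<rho>" using ratio_nonneg by simp
    moreover have "sqrt (1 + \<beta> * ?\<rho>) > 0" using den by simp
    ultimately have "sgn (shift (u, v)) * moment 2 (u, v) powr (- 1 / 2) * sqrt ?\<rho> * sqrt (1 + \<beta> * (sqrt ?\<rho>)\<^sup>2)
      = (sgn (shift (u, v)) * \<bar>shift (u, v)\<bar>) / (sqrt ?t * sqrt ?t)"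
      by simp
    then show ?thesis using t by (simp add: sgn_mult_abs)
  qed
  then show ?thesis using lim by (simp only:)
qed

section \<open>Limit points of the sample maximizers\<close>

lemma kurtosis_maximizers_feasible:
  assumes "kurtosis_maximizers x n d w" "j \<in> {1..d}" "k \<in> {1..<j}"
  shows "fst (w j) \<bullet> (G1 x n (w k) *v fst (w k)) = 0" "snd (w j) \<bullet> (G2 x n (w k) *v snd (w k)) = 0"
  using assms unfolding kurtosis_maximizers_def maximizers_def is_arg_max_def
  by (auto simp: case_prod_beta)

lemma kurtosis_maximizers_maximal:
  assumes "kurtosis_maximizers x n d w" "j \<in> {1..d}" "norm y = 1" "norm z = 1"
    and "\<And>k. k \<in> {1..<j} \<Longrightarrow> y \<bullet> (G1 x n (w k) *v fst (w k)) = 0"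
    and "\<And>k. k \<in> {1..<j} \<Longrightarrow> z \<bullet> (G2 x n (w k) *v snd (w k)) = 0"
  shows "sample_kurtosis x n (y, z) \<le> sample_kurtosis x n (w j)"
proof -
  have "\<not> (\<exists>yz. (case yz of (u, v) \<Rightarrow> u \<in> sphere 0 1 \<and> v \<in> sphere 0 1 \<and>
      (\<forall>k\<in>{1..<j}. u \<bullet> (G1 x n (w k) *v fst (w k)) = 0 \<and> v \<bullet> (G2 x n (w k) *v snd (w k)) = 0)) \<and>
      sample_kurtosis x n yz > sample_kurtosis x n (w j))"
    using assms(1,2) unfolding kurtosis_maximizers_def maximizers_def is_arg_max_def by blast
  moreover have "case (y, z) of (u, v) \<Rightarrow> u \<in> sphere 0 1 \<and> v \<in> sphere 0 1 \<and>
      (\<forall>k\<in>{1..<j}. u \<bullet> (G1 x n (w k) *v fst (w k)) = 0 \<and> v \<bullet> (G2 x n (w k) *v snd (w k)) = 0)"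
    using assms(3-) by simp
  ultimately show ?thesis by (meson not_le)
qed

text \<open>The constraints are homogeneous, so feasible approximants of a unit vector can be
  normalized; they are eventually nonzero.\<close>

lemma feasible_unit_approximation:
  fixes h :: "nat \<Rightarrow> nat \<Rightarrow> 'c::real_inner"
  assumes conv: "\<And>k y x. k \<in> {1..<j} \<Longrightarrow> y \<longlonglongrightarrow> x \<Longrightarrow> (\<lambda>n. y n \<bullet> h n k) \<longlonglongrightarrow> H k x"
    and e0: "\<And>k l. l \<in> {1..<j} \<Longrightarrow> k \<in> {1..<j} \<Longrightarrow> l < k \<Longrightarrow> H l (e k) = 0"
    and e1: "\<And>k. k \<in> {1..<j} \<Longrightarrow> H k (e k) \<noteq> 0"
    and x: "norm x = 1" "\<And>k. k \<in> {1..<j} \<Longrightarrow> H k x = 0"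
  shows "\<exists>y. y \<longlonglongrightarrow> x \<and> (\<forall>\<^sub>F n in sequentially. norm (y n) = 1 \<and> (\<forall>k\<in>{1..<j}. y n \<bullet> h n k = 0))"
proof -
  have "\<exists>y. y \<longlonglongrightarrow> x \<and> (\<forall>k\<in>{1..<j}. \<forall>\<^sub>F n in sequentially. y n \<bullet> h n k = 0)"
    by (rule feasible_approximation[where H = H and e = e]) (use assms in \<open>auto intro: linear_inner_left_const\<close>)
  then obtain y where y: "y \<longlonglongrightarrow> x" "\<forall>k\<in>{1..<j}. \<forall>\<^sub>F n in sequentially. y n \<bullet> h n k = 0" by blast
  have "(\<lambda>n. y n /\<^sub>R norm (y n)) \<longlonglongrightarrow> x /\<^sub>R norm x"
    using x(1) by (intro tendsto_intros y) auto
  moreover have feas: "\<forall>\<^sub>F n in sequentially. \<forall>k\<in>{1..<j}. y n \<bullet> h n k = 0"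
    using y(2) by (intro eventually_ball_finite) auto
  have "\<forall>\<^sub>F n in sequentially. y n \<noteq> 0"
    using y(1) x(1) by (intro tendsto_imp_eventually_ne) auto
  then have "\<forall>\<^sub>F n in sequentially. norm (y n /\<^sub>R norm (y n)) = 1 \<and>
      (\<forall>k\<in>{1..<j}. (y n /\<^sub>R norm (y n)) \<bullet> h n k = 0)"
    using feas by eventually_elim simp
  ultimately show ?thesis using x(1)
    by (intro exI[of _ "\<lambda>n. y n /\<^sub>R norm (y n)"]) simp
qed

text \<open>Strong induction on \<open>j\<close>. Since the earlier limits are singular pairs, the
  limiting constraints reduce to orthogonality to them. Feasibility passes to the limit directly;
  maximality does so because every admissible limit direction is approached by feasible sample
  directions. The variational step for singular pairs then applies.\<close>

lemma limit_singular_pairs: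
  fixes w :: "nat \<Rightarrow> nat \<Rightarrow> (real^'p) \<times> (real^'q)"
  assumes x: "monomial_averages_converge x" and r: "strict_mono r" and d: "d = rank D"
    and max: "\<And>n. kurtosis_maximizers x (r n) d (w n)"
    and u: "\<And>j. j \<in> {1..d} \<Longrightarrow> (\<lambda>n. fst (w n j)) \<longlonglongrightarrow> u j" "\<And>j. j \<in> {1..d} \<Longrightarrow> norm (u j) = 1"
    and v: "\<And>j. j \<in> {1..d} \<Longrightarrow> (\<lambda>n. snd (w n j)) \<longlonglongrightarrow> v j" "\<And>j. j \<in> {1..d} \<Longrightarrow> norm (v j) = 1"
    and a: "\<And>j. j \<in> {1..d} \<Longrightarrow> S *v u j = na j *\<^sub>R a j" "\<And>j. j \<in> {1..d} \<Longrightarrow> norm (a j) = 1"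
      "\<And>j. j \<in> {1..d} \<Longrightarrow> na j > 0"
    and b: "\<And>j. j \<in> {1..d} \<Longrightarrow> R *v v j = nb j *\<^sub>R b j" "\<And>j. j \<in> {1..d} \<Longrightarrow> norm (b j) = 1"
      "\<And>j. j \<in> {1..d} \<Longrightarrow> nb j > 0"
  defines "s \<equiv> \<lambda>j. a j \<bullet> (D *v b j)"
  shows "j \<in> {1..d} \<Longrightarrow> (\<forall>k\<in>{1..<j}. a j \<bullet> a k = 0 \<and> b j \<bullet> b k = 0) \<and>
    D *v b j = s j *\<^sub>R a j \<and> transpose D *v a j = s j *\<^sub>R b j \<and> s j \<noteq> 0"
proof (induction j rule: less_induct)
  case (less j)
  let ?K = "{1..<j}"
  have K: "k \<in> {1..d}" if "k \<in> ?K" for k using that less.prems by auto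
  have IH: "D *v b k = s k *\<^sub>R a k" "transpose D *v a k = s k *\<^sub>R b k" "s k \<noteq> 0"
    "\<And>l. l \<in> {1..<k} \<Longrightarrow> a k \<bullet> a l = 0 \<and> b k \<bullet> b l = 0" if "k \<in> ?K" for k
    using less.IH[of k] K[OF that] that by auto
  \<comment> \<open>The induction hypothesis relates each pair to smaller indices only; symmetry of
    the inner product supplies the other order.\<close>
  have orth: "a k \<bullet> a l = 0" "b k \<bullet> b l = 0" if "k \<in> ?K" "l \<in> ?K" "k \<noteq> l" for k l
    using IH(4)[of k l] IH(4)[of l k] that by (auto simp: inner_commute neq_iff)
  \<comment> \<open>\<open>H1 k\<close> and \<open>H2 k\<close> are the limits of the sample
    constraints belonging to pair \<open>k\<close>.\<close>
  define H1 where "H1 k y = (moment 2 (y + u k, v k) - moment 2 (y - u k, v k)) / 4" for k y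
  define H2 where "H2 k y = (moment 2 (u k, y + v k) - moment 2 (u k, y - v k)) / 4" for k y
  have one_pos: "1 + \<beta> * (s k)\<^sup>2 > 0" for k using \<beta>_pos by (intro add_pos_nonneg) auto
  have aa: "a k \<bullet> a k = 1" and bb: "b k \<bullet> b k = 1" if "k \<in> {1..d}" for k
    using a(2)[OF that] b(2)[OF that] by (simp_all add: dot_square_norm)
  \<comment> \<open>As \<open>D *v b k\<close> is a multiple of \<open>a k\<close>, the part due to
    the component means is proportional to the part due to the noise; both detect only the inner
    product with \<open>a k\<close>, with a positive total factor.\<close>
  have H1: "H1 k y = na k * (nb k)\<^sup>2 * (1 + \<beta> * (s k)\<^sup>2) * ((S *v y) \<bullet> a k)" if "k \<in> ?K" for k y
    unfolding H1_def polarized_moment_left a(1)[OF K[OF that]] b(1)[OF K[OF that]]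
    using aa[OF K[OF that]] b(2)[OF K[OF that]]
    by (simp add: matrix_vector_mult_scaleR IH(1)[OF that] power_mult_distrib power2_eq_square algebra_simps)
  have H2: "H2 k y = (na k)\<^sup>2 * nb k * (1 + \<beta> * (s k)\<^sup>2) * ((R *v y) \<bullet> b k)" if "k \<in> ?K" for k y
  proof -
    have "a k \<bullet> (D *v (R *v y)) = s k * ((R *v y) \<bullet> b k)"
      using inner_matrix_transpose[of "a k" D "R *v y"] unfolding IH(2)[OF that]
      by (simp only: inner_scaleR_left inner_commute[of "b k"])
    then show ?thesis
      unfolding H2_def polarized_moment_right a(1)[OF K[OF that]] b(1)[OF K[OF that]]
      using aa[OF K[OF that]] a(2)[OF K[OF that]]
      by (simp add: matrix_vector_mult_scaleR IH(1)[OF that] power_mult_distrib power2_eq_square algebra_simps)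
  qed
  have H1_0: "H1 k y = 0 \<longleftrightarrow> (S *v y) \<bullet> a k = 0" and H2_0: "H2 k z = 0 \<longleftrightarrow> (R *v z) \<bullet> b k = 0"
    if "k \<in> ?K" for k y z
    using H1[OF that, of y] H2[OF that, of z] a(3)[OF K[OF that]] b(3)[OF K[OF that]] one_pos[of k] by auto
  have conv1: "(\<lambda>n. y n \<bullet> (G1 x (r n) (w n k) *v fst (w n k))) \<longlonglongrightarrow> H1 k z" if "k \<in> ?K" "y \<longlonglongrightarrow> z" for k y z
  proof -
    have "y n \<bullet> (G1 x (r n) (w n k) *v fst (w n k)) = (proj_moment x (r n) 2 (y n + fst (w n k), snd (w n k))
        - proj_moment x (r n) 2 (y n - fst (w n k), snd (w n k))) / 4" for n
      using G1_bilinear[of "y n" x "r n" "fst (w n k)" "snd (w n k)"] by simp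
    then show ?thesis unfolding H1_def
      by (simp only:) (intro tendsto_intros proj_moment_tendsto[OF x _ r] u(1)[OF K] v(1)[OF K] that, simp_all)
  qed
  have conv2: "(\<lambda>n. y n \<bullet> (G2 x (r n) (w n k) *v snd (w n k))) \<longlonglongrightarrow> H2 k z" if "k \<in> ?K" "y \<longlonglongrightarrow> z" for k y z
  proof -
    have "y n \<bullet> (G2 x (r n) (w n k) *v snd (w n k)) = (proj_moment x (r n) 2 (fst (w n k), y n + snd (w n k))
        - proj_moment x (r n) 2 (fst (w n k), y n - snd (w n k))) / 4" for n
      using G2_bilinear[of "y n" x "r n" "fst (w n k)" "snd (w n k)"] by simp
    then show ?thesis unfolding H2_def
      by (simp only:) (intro tendsto_intros proj_moment_tendsto[OF x _ r] u(1)[OF K] v(1)[OF K] that, simp_all)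
  qed
  note j = less.prems
  have orth_j: "a j \<bullet> a k = 0" "b j \<bullet> b k = 0" if k: "k \<in> ?K" for k
  proof -
    \<comment> \<open>The sample constraint is 0 for every \<open>n\<close>, hence so is its
      limit.\<close>
    have "H1 k (u j) = 0"
      using conv1[OF k u(1)[OF j]] kurtosis_maximizers_feasible(1)[OF max j k] LIMSEQ_unique[OF _ tendsto_const] by simp
    then show "a j \<bullet> a k = 0" using a(3)[OF j] by (simp add: H1_0[OF k] a(1)[OF j])
    have "H2 k (v j) = 0"
      using conv2[OF k v(1)[OF j]] kurtosis_maximizers_feasible(2)[OF max j k] LIMSEQ_unique[OF _ tendsto_const] by simp
    then show "b j \<bullet> b k = 0" using b(3)[OF j] by (simp add: H2_0[OF k] b(1)[OF j])
  qed
  have uv0: "u j \<noteq> 0" "v j \<noteq> 0" using u(2)[OF j] v(2)[OF j] by auto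
  have maximal: "(x' \<bullet> (D *v y'))\<^sup>2 \<le> (a j \<bullet> (D *v b j))\<^sup>2"
    if x': "norm x' = 1" "\<And>k. k \<in> ?K \<Longrightarrow> x' \<bullet> a k = 0" and y': "norm y' = 1" "\<And>k. k \<in> ?K \<Longrightarrow> y' \<bullet> b k = 0"
    for x' y'
  proof -
    \<comment> \<open>The whitened competitor is pulled back to original coordinates and then scaled
      to unit length, which leaves the ratio unchanged.\<close>
    define p q where "p = matrix_inv S *v x'" and "q = matrix_inv R *v y'"
    have Sp: "S *v p = x'" and Rq: "R *v q = y'"
      unfolding p_def q_def by (simp_all add: matrix_vector_mul_assoc S_inv R_inv)
    have p0: "p \<noteq> 0" and q0: "q \<noteq> 0" using Sp Rq x'(1) y'(1) by auto
    define p' q' where "p' = p /\<^sub>R norm p" and "q' = q /\<^sub>R norm q"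
    have Sp': "S *v p' = inverse (norm p) *\<^sub>R x'" and Rq': "R *v q' = inverse (norm q) *\<^sub>R y'"
      by (simp_all add: p'_def q'_def matrix_vector_mult_scaleR Sp Rq)
    have n: "norm p' = 1" "norm q' = 1" using p0 q0 by (simp_all add: p'_def q'_def)
    have "\<exists>y. y \<longlonglongrightarrow> p' \<and> (\<forall>\<^sub>F n in sequentially. norm (y n) = 1 \<and>
        (\<forall>k\<in>?K. y n \<bullet> (G1 x (r n) (w n k) *v fst (w n k)) = 0))"
    proof (rule feasible_unit_approximation[where H = H1 and e = u])
      \<comment> \<open>The earlier limit directions themselves serve as correction directions;
        their whitened orthogonality gives the triangular condition.\<close>
      show "H1 l (u k) = 0" if "l \<in> ?K" "k \<in> ?K" "l < k" for k l
        using orth(1)[OF that(2,1)] that(3) by (simp add: H1_0[OF that(1)] a(1)[OF K[OF that(2)]])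
      show "H1 k (u k) \<noteq> 0" if "k \<in> ?K" for k
        using a(3)[OF K[OF that]] aa[OF K[OF that]] by (simp add: H1_0[OF that] a(1)[OF K[OF that]])
      show "H1 k p' = 0" if "k \<in> ?K" for k by (simp add: H1_0[OF that] Sp' x'(2)[OF that])
    qed (use conv1 n in auto)
    then obtain yu where yu: "yu \<longlonglongrightarrow> p'" "\<forall>\<^sub>F n in sequentially. norm (yu n) = 1 \<and>
        (\<forall>k\<in>?K. yu n \<bullet> (G1 x (r n) (w n k) *v fst (w n k)) = 0)" by blast
    have "\<exists>y. y \<longlonglongrightarrow> q' \<and> (\<forall>\<^sub>F n in sequentially. norm (y n) = 1 \<and>
        (\<forall>k\<in>?K. y n \<bullet> (G2 x (r n) (w n k) *v snd (w n k)) = 0))"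
    proof (rule feasible_unit_approximation[where H = H2 and e = v])
      show "H2 l (v k) = 0" if "l \<in> ?K" "k \<in> ?K" "l < k" for k l
        using orth(2)[OF that(2,1)] that(3) by (simp add: H2_0[OF that(1)] b(1)[OF K[OF that(2)]])
      show "H2 k (v k) \<noteq> 0" if "k \<in> ?K" for k
        using b(3)[OF K[OF that]] bb[OF K[OF that]] by (simp add: H2_0[OF that] b(1)[OF K[OF that]])
      show "H2 k q' = 0" if "k \<in> ?K" for k by (simp add: H2_0[OF that] Rq' y'(2)[OF that])
    qed (use conv2 n in auto)
    then obtain yv where yv: "yv \<longlonglongrightarrow> q'" "\<forall>\<^sub>F n in sequentially. norm (yv n) = 1 \<and>
        (\<forall>k\<in>?K. yv n \<bullet> (G2 x (r n) (w n k) *v snd (w n k)) = 0)" by blast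
    have p'0: "p' \<noteq> 0" and q'0: "q' \<noteq> 0" using n by auto
    have "kurtosis (p', q') \<le> kurtosis (u j, v j)"
    proof (rule tendsto_le[OF sequentially_bot])
      show "(\<lambda>n. sample_kurtosis x (r n) (yu n, yv n)) \<longlonglongrightarrow> kurtosis (p', q')"
        by (rule sample_kurtosis_tendsto[OF x r yu(1) yv(1) p'0 q'0])
      show "(\<lambda>n. sample_kurtosis x (r n) (fst (w n j), snd (w n j))) \<longlonglongrightarrow> kurtosis (u j, v j)"
        by (rule sample_kurtosis_tendsto[OF x r u(1)[OF j] v(1)[OF j] uv0])
      show "\<forall>\<^sub>F n in sequentially. sample_kurtosis x (r n) (yu n, yv n)
          \<le> sample_kurtosis x (r n) (fst (w n j), snd (w n j))"
        using yu(2) yv(2)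
      proof eventually_elim
        case (elim n)
        then show ?case using kurtosis_maximizers_maximal[OF max j, of "yu n" "yv n" n] by simp
      qed
    qed
    then have "ratio (p', q') \<le> ratio (u j, v j)"
      by (rule ratio_le_if_kurtosis_le[OF p'0 q'0 uv0])
    moreover have "ratio (p', q') = (x' \<bullet> (D *v y'))\<^sup>2"
      using p0 q0 x'(1) y'(1) by (intro ratio_eq[OF Sp' Rq']) auto
    moreover have "ratio (u j, v j) = (a j \<bullet> (D *v b j))\<^sup>2"
      using a(2,3)[OF j] b(2,3)[OF j] by (intro ratio_eq[OF a(1)[OF j] b(1)[OF j]]) auto
    ultimately show ?thesis by simp
  qed
  \<comment> \<open>There are \<open>j - 1\<close> earlier pairs and
    \<open>j \<le> d = rank D\<close>, so a nonzero singular value is still left.\<close>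
  have card: "card ?K < rank D" using j d by auto
  have "D *v b j = s j *\<^sub>R a j" "transpose D *v a j = s j *\<^sub>R b j" "s j \<noteq> 0"
    unfolding s_def
    using singular_pair_step[where a = a and b = b and s = s and K = ?K, OF finite_atLeastLessThan card a(2)[OF K] orth(1) b(2)[OF K] orth(2)
        IH(1,2) a(2)[OF j] orth_j(1) b(2)[OF j] orth_j(2) maximal] by blast+
  then show ?case using orth_j by blast
qed

section \<open>Identification of the limit\<close>

lemma W_LDA_eq: "W_LDA A B T\<^sub>1 T\<^sub>2 = matrix_inv S ** D ** matrix_inv R"
proof -
  have "A ** (matrix_inv S ** matrix_inv S) = mat 1"
  proof -
    have "A ** (matrix_inv S ** matrix_inv S) = S ** (S ** matrix_inv S) ** matrix_inv S"
      by (metis S(2) matrix_mul_assoc)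
    then show ?thesis by (simp add: S_inv)
  qed
  then have A: "matrix_inv A = matrix_inv S ** matrix_inv S" by (rule matrix_inv_unique)
  have "B ** (matrix_inv R ** matrix_inv R) = mat 1"
  proof -
    have "B ** (matrix_inv R ** matrix_inv R) = R ** (R ** matrix_inv R) ** matrix_inv R"
      by (metis R(2) matrix_mul_assoc)
    then show ?thesis by (simp add: R_inv)
  qed
  then have B: "matrix_inv B = matrix_inv R ** matrix_inv R" by (rule matrix_inv_unique)
  show ?thesis by (simp add: W_LDA_def A B D_def matrix_mul_assoc)
qed

lemma transpose_matrix_inv_R: "transpose (matrix_inv R) = matrix_inv R"
proof -
  have "transpose R = R" using R(1) by (simp add: sym_pos_def_def)
  then have "R ** transpose (matrix_inv R) = transpose (matrix_inv R ** R)"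
    by (simp add: matrix_transpose_mul)
  then have "R ** transpose (matrix_inv R) = mat 1" by (simp add: R_inv)
  then show ?thesis by (rule matrix_inv_unique[symmetric])
qed

lemma outer_scaleR: "outer (c *\<^sub>R x) (c' *\<^sub>R y) = (c * c') *\<^sub>R outer x y"
  by (simp add: outer_def vec_eq_iff)

text \<open>The outer product contributes the factor \<open>c * c'\<close> when the directions are
  expressed through \<open>a\<close> and \<open>b\<close>, and \<delta> / \<tau> contributes its
  inverse; only the signed singular value remains.\<close>

lemma outer_singular_pair:
  assumes a: "S *v u = c *\<^sub>R a" "c > 0" "norm a = 1" and b: "R *v v = c' *\<^sub>R b" "c' > 0" "norm b = 1"
  shows "(shift (u, v) / scale (u, v)) *\<^sub>R outer u v
    = matrix_inv S ** ((a \<bullet> (D *v b)) *\<^sub>R outer a b) ** matrix_inv R"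
proof -
  have "u = matrix_inv S *v (S *v u)" by (simp add: matrix_vector_mul_assoc S_inv)
  then have u: "u = c *\<^sub>R (matrix_inv S *v a)" by (simp only: a(1) matrix_vector_mult_scaleR)
  have "v = matrix_inv R *v (R *v v)" by (simp add: matrix_vector_mul_assoc R_inv)
  then have v: "v = c' *\<^sub>R (matrix_inv R *v b)" by (simp only: b(1) matrix_vector_mult_scaleR)
  have "(shift (u, v) / scale (u, v)) * (c * c') = a \<bullet> (D *v b)"
    using a b by (simp add: shift_eq scale_eq matrix_vector_mult_scaleR power2_eq_square)
  moreover have "outer u v = (c * c') *\<^sub>R outer (matrix_inv S *v a) (matrix_inv R *v b)"
    unfolding outer_scaleR[symmetric] u[symmetric] v[symmetric] ..
  ultimately have "(shift (u, v) / scale (u, v)) *\<^sub>R outer u v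
      = (a \<bullet> (D *v b)) *\<^sub>R outer (matrix_inv S *v a) (matrix_inv R *v b)"
    by simp
  also have "outer (matrix_inv S *v a) (matrix_inv R *v b) = matrix_inv S ** outer a b ** matrix_inv R"
    by (simp only: matrix_mult_outer_mult transpose_matrix_inv_R)
  finally show ?thesis
    by (simp add: scalar_matrix_assoc matrix_scalar_ac)
qed

text \<open>Every subsequence has a further one along which all pairs converge. The limiting pairs
  may depend on it, but their weighted sum is always the singular value decomposition of
  \<open>D\<close>, transformed back.\<close>

theorem W_nLDA_tendsto:
  assumes x: "monomial_averages_converge x" and d: "d = rank D"
    and max: "\<And>n. n > N \<Longrightarrow> kurtosis_maximizers x n d (w n)"
  shows "(\<lambda>n. W_nLDA \<alpha>\<^sub>1 \<alpha>\<^sub>2 x n d (w n)) \<longlonglongrightarrow> W_LDA A B T\<^sub>1 T\<^sub>2"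
proof (rule tendsto_if_subseq_tendsto)
  fix r :: "nat \<Rightarrow> nat" assume r: "strict_mono r"
  \<comment> \<open>The shift by \<open>Suc N\<close> puts all indices beyond \<open>N\<close>,
    where the maximizing property is available. It reappears in the final choice of the
    subsequence.\<close>
  define r' where "r' n = r (n + Suc N)" for n
  have r': "strict_mono r'" using r by (auto simp: strict_mono_def r'_def)
  have gt: "r' n > N" for n using seq_suble[OF r, of "n + Suc N"] by (simp add: r'_def)
  have sphere: "w (r' n) j \<in> sphere 0 1 \<times> sphere 0 1" if "j \<in> {1..d}" for n j
    using max[OF gt] that unfolding kurtosis_maximizers_def maximizers_def is_arg_max_def
    by (auto simp: case_prod_beta mem_Times_iff)
  have "\<exists>s l. strict_mono s \<and> (\<forall>j\<in>{1..d}. l j \<in> sphere 0 1 \<times> sphere 0 1 \<and> (\<lambda>n. w (r' (s n)) j) \<longlonglongrightarrow> l j)"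
    using sphere by (intro finite_family_convergent_subseq[where f = "\<lambda>n. w (r' n)"] compact_Times) auto
  then obtain s l where s: "strict_mono s"
    and l: "\<And>j. j \<in> {1..d} \<Longrightarrow> l j \<in> sphere 0 1 \<times> sphere 0 1"
      "\<And>j. j \<in> {1..d} \<Longrightarrow> (\<lambda>n. w (r' (s n)) j) \<longlonglongrightarrow> l j" by blast
  define t where "t n = r' (s n)" for n
  have t: "strict_mono t" using strict_mono_o[OF r' s] by (simp add: t_def[abs_def] comp_def)
  define u v where "u j = fst (l j)" and "v j = snd (l j)" for j
  have unit: "norm (u j) = 1" "norm (v j) = 1" if "j \<in> {1..d}" for j
    using l(1)[OF that] by (auto simp: u_def v_def mem_Times_iff)
  have lim: "(\<lambda>n. fst (w (t n) j)) \<longlonglongrightarrow> u j" "(\<lambda>n. snd (w (t n) j)) \<longlonglongrightarrow> v j" if "j \<in> {1..d}" for j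
    unfolding u_def v_def t_def using l(2)[OF that] by (intro tendsto_fst tendsto_snd; assumption)+
  define na nb where "na j = norm (S *v u j)" and "nb j = norm (R *v v j)" for j
  define a b where "a j = (S *v u j) /\<^sub>R na j" and "b j = (R *v v j) /\<^sub>R nb j" for j
  have uv0: "u j \<noteq> 0" "v j \<noteq> 0" if "j \<in> {1..d}" for j using unit[OF that] by auto
  have a: "S *v u j = na j *\<^sub>R a j" "norm (a j) = 1" "na j > 0"
    and b: "R *v v j = nb j *\<^sub>R b j" "norm (b j) = 1" "nb j > 0" if "j \<in> {1..d}" for j
    using uv0[OF that] by (simp_all add: a_def b_def na_def nb_def)
  have max_t: "kurtosis_maximizers x (t n) d (w (t n))" for n
    unfolding t_def by (intro max gt)
  let ?s = "\<lambda>j. a j \<bullet> (D *v b j)"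
  have pairs: "(\<forall>k\<in>{1..<j}. a j \<bullet> a k = 0 \<and> b j \<bullet> b k = 0) \<and>
    D *v b j = ?s j *\<^sub>R a j \<and> transpose D *v a j = ?s j *\<^sub>R b j \<and> ?s j \<noteq> 0" if "j \<in> {1..d}" for j
    by (rule limit_singular_pairs[where w = "\<lambda>n. w (t n)" and u = u and v = v and na = na and nb = nb,
        OF x t d max_t]) (use lim unit a b that in blast)+
  have decomposition: "D = (\<Sum>j\<in>{1..d}. ?s j *\<^sub>R outer (a j) (b j))"
  proof (rule singular_value_decomposition_complete)
    fix j k assume jk: "j \<in> {1..d}" "k \<in> {1..d}" "j \<noteq> k"
    show "a j \<bullet> a k = 0" "b j \<bullet> b k = 0"
      using pairs[OF jk(1)] pairs[OF jk(2)] jk by (auto simp: inner_commute neq_iff)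
  qed (use pairs a(2) b(2) d in auto)
  \<comment> \<open>The singular values found are nonzero, so each limiting gap is nonzero and the
    weights converge.\<close>
  have shift0: "shift (u j, v j) \<noteq> 0" if "j \<in> {1..d}" for j
    using pairs[OF that] a[OF that] b[OF that]
    by (simp add: shift_eq a(1)[OF that] b(1)[OF that] matrix_vector_mult_scaleR)
  have "(\<lambda>n. \<Sum>j=1..d. coefficient x (t n) (fst (w (t n) j), snd (w (t n) j)) *\<^sub>R outer (fst (w (t n) j)) (snd (w (t n) j)))
      \<longlonglongrightarrow> (\<Sum>j=1..d. (shift (u j, v j) / scale (u j, v j)) *\<^sub>R outer (u j) (v j))"
    unfolding outer_def
    by (intro tendsto_sum tendsto_scaleR coefficient_tendsto x t lim uv0 shift0 tendsto_vec_lambda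
        tendsto_mult tendsto_vec_nth) auto
  moreover have "(\<Sum>j=1..d. (shift (u j, v j) / scale (u j, v j)) *\<^sub>R outer (u j) (v j)) = W_LDA A B T\<^sub>1 T\<^sub>2"
  proof -
    have "(\<Sum>j=1..d. (shift (u j, v j) / scale (u j, v j)) *\<^sub>R outer (u j) (v j))
        = (\<Sum>j=1..d. matrix_inv S ** (?s j *\<^sub>R outer (a j) (b j)) ** matrix_inv R)"
      by (rule sum.cong[OF refl], rule outer_singular_pair[OF a(1,3,2) b(1,3,2)]) assumption+
    also have "\<dots> = matrix_inv S ** (\<Sum>j=1..d. ?s j *\<^sub>R outer (a j) (b j)) ** matrix_inv R"
      by (simp only: sum_matrix_mult_left sum_matrix_mult_right)
    finally show ?thesis by (simp only: W_LDA_eq decomposition[symmetric])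
  qed
  ultimately have "(\<lambda>n. W_nLDA \<alpha>\<^sub>1 \<alpha>\<^sub>2 x (t n) d (w (t n))) \<longlonglongrightarrow> W_LDA A B T\<^sub>1 T\<^sub>2"
    by (simp add: W_nLDA_def coefficient_def)
  then show "\<exists>s. strict_mono s \<and> (\<lambda>n. W_nLDA \<alpha>\<^sub>1 \<alpha>\<^sub>2 x (r (s n)) d (w (r (s n)))) \<longlonglongrightarrow> W_LDA A B T\<^sub>1 T\<^sub>2"
    using s by (intro exI[of _ "\<lambda>n. s n + Suc N"]) (auto simp: t_def r'_def strict_mono_def)
qed

end

section \<open>Almost sure convergence of the discriminant matrix\<close>

theorem corollary3:
  fixes M :: "'w measure"
    and X :: "nat \<Rightarrow> 'w \<Rightarrow> real^'q^'p"
    and A :: "real^'p^'p" and B :: "real^'q^'q"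
    and T\<^sub>1 T\<^sub>2 :: "real^'q^'p"
    and \<alpha>\<^sub>1 \<alpha>\<^sub>2 :: real
    and d :: nat
    and u :: "nat \<Rightarrow> nat \<Rightarrow> 'w \<Rightarrow> real^'p" and v :: "nat \<Rightarrow> nat \<Rightarrow> 'w \<Rightarrow> real^'q"
  assumes "prob_space M"
    and "0 < \<alpha>\<^sub>1" and "\<alpha>\<^sub>1 < 1" and "\<bar>\<alpha>\<^sub>1 - 1 / 2\<bar> > 1 / sqrt 12" and "\<alpha>\<^sub>2 = 1 - \<alpha>\<^sub>1"
    and "sym_pos_def A" and "sym_pos_def B"
    and "T\<^sub>1 \<noteq> T\<^sub>2"
    and "prob_space.indep_vars M (\<lambda>_. borel) X {1..}"
    and "\<And>i. i \<ge> 1 \<Longrightarrow>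
      distr M borel (X i) = mixture \<alpha>\<^sub>1 (matrix_normal T\<^sub>1 A B) \<alpha>\<^sub>2 (matrix_normal T\<^sub>2 A B)"
    and "d = rank (matrix_inv (mat_sqrt A) ** (T\<^sub>2 - T\<^sub>1) ** matrix_inv (mat_sqrt B))"
    and "nonzero_singular_values_distinct
      (matrix_inv (mat_sqrt A) ** (T\<^sub>2 - T\<^sub>1) ** matrix_inv (mat_sqrt B))"
    and "\<And>n. n > CARD('p) * CARD('q) \<Longrightarrow>
      AE \<omega> in M. kurtosis_maximizers (\<lambda>i. X i \<omega>) n d (\<lambda>j. (u n j \<omega>, v n j \<omega>))"
  shows "AE \<omega> in M. (\<lambda>n. W_nLDA \<alpha>\<^sub>1 \<alpha>\<^sub>2 (\<lambda>i. X i \<omega>) n d (\<lambda>j. (u n j \<omega>, v n j \<omega>)))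
      \<longlonglongrightarrow> W_LDA A B T\<^sub>1 T\<^sub>2"
proof -
  have prod: "6 * (\<alpha>\<^sub>1 * \<alpha>\<^sub>2) < 1"
  proof -
    have "(1 / sqrt 12)\<^sup>2 < \<bar>\<alpha>\<^sub>1 - 1 / 2\<bar>\<^sup>2"
      using assms(4) by (intro power_strict_mono) auto
    then have "1 / 12 < (\<alpha>\<^sub>1 - 1 / 2)\<^sup>2" by (simp add: power_divide)
    \<comment> \<open>The square equals \<open>1 / 4 - \<alpha>\<^sub>1 * \<alpha>\<^sub>2\<close>,
      so the product of the weights is below \<open>1 / 4 - 1 / 12 = 1 / 6\<close>.\<close>
    then show ?thesis unfolding assms(5) by (simp add: power2_eq_square algebra_simps)
  qed
  interpret discriminant_mixture \<alpha>\<^sub>1 \<alpha>\<^sub>2 A B T\<^sub>1 T\<^sub>2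
    using assms(2,3,5-7) prod by unfold_locales auto
  have "AE \<omega> in M. monomial_averages_converge (\<lambda>i. X i \<omega>)"
    using assms(1,9,10) by (intro AE_monomial_averages_converge) (auto simp: law_def)
  \<comment> \<open>The exceptional null set may depend on \<open>n\<close>; countably many of them
    are combined into one.\<close>
  moreover have "AE \<omega> in M. \<forall>n. n > CARD('p) * CARD('q) \<longrightarrow>
      kurtosis_maximizers (\<lambda>i. X i \<omega>) n d (\<lambda>j. (u n j \<omega>, v n j \<omega>))"
    unfolding AE_all_countable using assms(13) by auto
  ultimately show ?thesis
  proof eventually_elim
    case (elim \<omega>)
    then show ?case
      using assms(11) by (intro W_nLDA_tendsto[where N = "CARD('p) * CARD('q)"]) (auto simp: D_def)
  qed
qed

end
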